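(* Let $G$ be a connected simple cubic graph of girth 4 and let $M(G)$ be a $\Pi$-map of $G$ in an orientable surface $S$ of genus $g(G)$. Then there is a one-to-one correspondence between the DETGCs $\mu'$ of $M(G)$ and the PFCs $\mu$ of $M(G)$, and likewise a one-to-one correspondence between the RETGCs $\mu'$ of $M(G)$ and the PFCs $\mu$ of $M(G)$ (here $\mu$ denotes the PFC associated with $\mu'$).
   Context: Write $[3]_0=\{0,1,2,3\}$. $G$ is a connected simple cubic graph of girth 4, and $g(G)$ is its genus. A set $S_0\subseteq V(G)$ is an efficient dominating set (EDS) if $|N_G[v]\cap S_0|=1$ for every $v\in V(G)$. A total coloring colors vertices and edges so that no two incident or adjacent elements get the same color. An efficient total coloring (ETC) of $G$ is a total coloring $\mu:V(G)\cup E(G)\to[3]_0$ such that for each vertex $v$ the restriction of $\mu$ to $N_G[v]$ is a bijection onto $[3]_0$, and the four vertex color classes partition $V(G)$ into EDSs. An ETGC is an ETC in which every 4-cycle of $G$ has each of the four colors exactly once on its vertices and exactly once on its edges. A map $M(G)$ is an embedding of $G$ in a connected closed orientable surface $S$ of genus $g(G)$ such that the components of $S\setminus G$ are open disks; closures of these disks are the faces, and a belt is a face boundary cycle (an $\ell$-belt if it has length $\ell$). A vertex of $G$ in no 4-cycle of $G$ is a Y-vertex; an edge with both ends Y-vertices is a Y-edge. A $2\ell$-belt with consecutive edges $(e_1,\dots,e_{2\ell})$ is a Y-belt if its Y-edges, if any, occur only in opposite pairs $\{e_h,e_{h+\ell}\}$, $1\le h\le\ell$. $M(G)$ is a Y-map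 if all belts have even length and are Y-belts. A $\Pi$-map is a Y-map $M(G)$ for which $V(G)$ admits a partition into four EDSs, labelled $0,1,2,3$, such that the cyclic sequence of vertex colors of each $\ell$-belt has the form $(a,b,c,d)^{\ell/4}$ with $\{a,b,c,d\}=[3]_0$. Given an ETGC of a $\Pi$-map, a belt is directed (resp. reversed) if each color-0 edge $e$ on it lies in the clockwise (resp. counterclockwise) direction from a color-0 vertex $v$ of the belt, with distance 1 from $v$ to the nearest end-vertex of $e$. (Clockwise is with respect to the orientation of the face.) An ETGC is a DETGC (resp. RETGC) if every belt is directed (resp. reversed). An ETGC is periodic if for each belt, traversed in one of its two directions, the alternating cyclic sequence of colors (vertex, edge, vertex, edge, ...) is a concatenation of copies of $a,b,c,a,d,c,b,d$ for some $\{a,b,c,d\}=[3]_0$ (odd positions vertex colors, even positions edge colors). Given a periodic ETGC $\mu'$ of a $\Pi$-map $M(G)$, its associated 3-permutation face coloring $\mu$ assigns to the face with belt $B$ the permutation $\mu(B)=abc$ of $\{1,2,3\}$, where $0,a,b,c$ are the $\mu'$-colors of four consecutive vertices of $B$ in clockwise order starting at a vertex of color $0$. A PFC of $M(G)$ is a face coloring by 3-permutations obtained in this way from a periodic ETGC of $M(G)$.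
   Formalization: DETGCs and RETGCs are taken only among ETGCs whose vertex colors along each belt have the Π-map form (a,b,c,d)^{ℓ/4}; without this, a Π-map on the torus with 24 vertices has extra non-periodic DETGCs with no associated PFC. *)

theory Defs
  imports
    Graph_Theory.Graph_Theory
    "HOL-Combinatorics.Orbits"
    "HOL-Library.FuncSet"
    "HOL-Library.Extended_Nat"
begin

text \<open>
  Finite simple graphs are the \<^locale>\<open>pair_graph\<close>s of the library: finite, loop-free, symmetric
  arc relations. An undirected edge is the set of the two ends of an arc.
\<close>

definition uedge :: "'a \<times> 'a \<Rightarrow> 'a set" where
  "uedge e = {fst e, snd e}"

definition uedges :: "'a pair_pre_digraph \<Rightarrow> 'a set set" where
  "uedges G = uedge ` parcs G"

definition cubic :: "'a pair_pre_digraph \<Rightarrow> bool" where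
  "cubic G \<longleftrightarrow> (\<forall>v \<in> pverts G. out_degree (with_proj G) v = 3)"

text \<open>The library's notion of cycle admits \<open>u \<rightarrow> v \<rightarrow> u\<close>, hence the condition on the length.\<close>

definition graph_cycle :: "'a pair_pre_digraph \<Rightarrow> ('a \<times> 'a) list \<Rightarrow> bool" where
  "graph_cycle G p \<longleftrightarrow> pre_digraph.cycle (with_proj G) p \<and> length p \<ge> 3"

definition girth :: "'a pair_pre_digraph \<Rightarrow> enat" where
  "girth G = (INF p \<in> {p. graph_cycle G p}. enat (length p))"

definition closed_nbhd :: "'a pair_pre_digraph \<Rightarrow> 'a \<Rightarrow> 'a set" where
  "closed_nbhd G v = insert v {w. (v, w) \<in> parcs G}"


section \<open>Efficient domination and total colourings\<close>

definition efficient_dominating :: "'a pair_pre_digraph \<Rightarrow> 'a set \<Rightarrow> bool" where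
  "efficient_dominating G S \<longleftrightarrow>
     S \<subseteq> pverts G \<and> (\<forall>v \<in> pverts G. card (closed_nbhd G v \<inter> S) = 1)"

text \<open>A partition of the vertex set into four sets labelled 0, 1, 2, 3 is given by its labelling.\<close>

definition eds_partition :: "'a pair_pre_digraph \<Rightarrow> ('a \<Rightarrow> nat) \<Rightarrow> bool" where
  "eds_partition G c \<longleftrightarrow>
     c \<in> pverts G \<rightarrow> {0..3} \<and> (\<forall>i \<in> {0..3}. efficient_dominating G {v \<in> pverts G. c v = i})"

text \<open>
  A colouring of vertices and edges is a function on the disjoint union of the two sets. It is
  extensional, so that two colourings are equal iff they agree on all vertices and edges of \<open>G\<close>.
\<close>

type_synonym 'a total_col = "'a + 'a set \<Rightarrow> nat"

definition vcol :: "'a total_col \<Rightarrow> 'a \<Rightarrow> nat" where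
  "vcol \<mu> v = \<mu> (Inl v)"

definition ecol :: "'a total_col \<Rightarrow> 'a \<times> 'a \<Rightarrow> nat" where
  "ecol \<mu> e = \<mu> (Inr (uedge e))"

definition total_coloring :: "'a pair_pre_digraph \<Rightarrow> 'a total_col \<Rightarrow> bool" where
  "total_coloring G \<mu> \<longleftrightarrow>
     \<mu> \<in> (pverts G <+> uedges G) \<rightarrow>\<^sub>E {0..3} \<and>
     (\<forall>(u, v) \<in> parcs G. vcol \<mu> u \<noteq> vcol \<mu> v) \<and>
     (\<forall>e \<in> uedges G. \<forall>v \<in> e. \<mu> (Inl v) \<noteq> \<mu> (Inr e)) \<and>
     (\<forall>e \<in> uedges G. \<forall>f \<in> uedges G. e \<noteq> f \<and> e \<inter> f \<noteq> {} \<longrightarrow> \<mu> (Inr e) \<noteq> \<mu> (Inr f))"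

definition ETC :: "'a pair_pre_digraph \<Rightarrow> 'a total_col \<Rightarrow> bool" where
  "ETC G \<mu> \<longleftrightarrow>
     total_coloring G \<mu> \<and>
     (\<forall>v \<in> pverts G. bij_betw (vcol \<mu>) (closed_nbhd G v) {0..3}) \<and>
     eds_partition G (vcol \<mu>)"

definition ETGC :: "'a pair_pre_digraph \<Rightarrow> 'a total_col \<Rightarrow> bool" where
  "ETGC G \<mu> \<longleftrightarrow>
     ETC G \<mu> \<and>
     (\<forall>p. graph_cycle G p \<and> length p = 4 \<longrightarrow>
        bij_betw (\<lambda>e. vcol \<mu> (fst e)) (set p) {0..3} \<and> bij_betw (ecol \<mu>) (set p) {0..3})"


section \<open>Maps\<close>

text \<open>
  Embeddings of a connected graph in closed oriented surfaces with all complementary components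
  open disks are represented combinatorially by rotation systems: \<open>\<sigma>\<close> sends an arc leaving a
  vertex to the next arc leaving it, counterclockwise.
\<close>

definition rotation_system :: "'a pair_pre_digraph \<Rightarrow> ('a \<times> 'a \<Rightarrow> 'a \<times> 'a) \<Rightarrow> bool" where
  "rotation_system G \<sigma> \<longleftrightarrow>
     \<sigma> permutes parcs G \<and> (\<forall>e \<in> parcs G. orbit \<sigma> e = out_arcs (with_proj G) (fst e))"

text \<open>
  Arriving at \<open>v\<close> along \<open>(u, v)\<close>, the arc following \<open>(v, u)\<close> counterclockwise is the rightmost turn.
  Iterating this step walks once around the face to the right of \<open>(u, v)\<close>, which lies on the
  right-hand side throughout: the boundary is traversed clockwise.
\<close>

definition face_step :: "('a \<times> 'a \<Rightarrow> 'a \<times> 'a) \<Rightarrow> 'a \<times> 'a \<Rightarrow> 'a \<times> 'a" where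
  "face_step \<sigma> e = \<sigma> (prod.swap e)"

definition faces :: "'a pair_pre_digraph \<Rightarrow> ('a \<times> 'a \<Rightarrow> 'a \<times> 'a) \<Rightarrow> ('a \<times> 'a) set set" where
  "faces G \<sigma> = orbit (face_step \<sigma>) ` parcs G"

text \<open>
  The clockwise cyclic sequence of arcs of the boundary of a face, cut open at the arc \<open>e\<close>. Its
  vertices are the tails of the arcs. The boundary of a face is not required to be a cycle; in the
  \<open>\<Pi>\<close>-maps below this is automatic.
\<close>

definition belt :: "('a \<times> 'a \<Rightarrow> 'a \<times> 'a) \<Rightarrow> 'a \<times> 'a \<Rightarrow> ('a \<times> 'a) list" where
  "belt \<sigma> e = map (\<lambda>i. (face_step \<sigma> ^^ i) e) [0..<card (orbit (face_step \<sigma>) e)]"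

text \<open>The genus \<open>g\<close> of the surface is determined by Euler's formula \<open>V - E + F = 2 - 2g\<close>.\<close>

definition surface_genus :: "'a pair_pre_digraph \<Rightarrow> ('a \<times> 'a \<Rightarrow> 'a \<times> 'a) \<Rightarrow> int" where
  "surface_genus G \<sigma> =
     (2 - (int (card (pverts G)) - int (card (uedges G)) + int (card (faces G \<sigma>)))) div 2"

definition graph_genus :: "'a pair_pre_digraph \<Rightarrow> int" where
  "graph_genus G = Min (surface_genus G ` {\<sigma>. rotation_system G \<sigma>})"

definition is_map :: "'a pair_pre_digraph \<Rightarrow> ('a \<times> 'a \<Rightarrow> 'a \<times> 'a) \<Rightarrow> bool" where
  "is_map G \<sigma> \<longleftrightarrow> rotation_system G \<sigma> \<and> surface_genus G \<sigma> = graph_genus G"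

definition Y_vertex :: "'a pair_pre_digraph \<Rightarrow> 'a \<Rightarrow> bool" where
  "Y_vertex G v \<longleftrightarrow>
     v \<in> pverts G \<and> \<not> (\<exists>p. graph_cycle G p \<and> length p = 4 \<and> v \<in> fst ` set p)"

definition Y_edge :: "'a pair_pre_digraph \<Rightarrow> 'a \<times> 'a \<Rightarrow> bool" where
  "Y_edge G e \<longleftrightarrow> Y_vertex G (fst e) \<and> Y_vertex G (snd e)"

definition Y_belt :: "'a pair_pre_digraph \<Rightarrow> ('a \<times> 'a) list \<Rightarrow> bool" where
  "Y_belt G b \<longleftrightarrow>
     (\<exists>l. length b = 2 * l \<and> (\<forall>h < l. Y_edge G (b ! h) \<longleftrightarrow> Y_edge G (b ! (h + l))))"

definition Y_map :: "'a pair_pre_digraph \<Rightarrow> ('a \<times> 'a \<Rightarrow> 'a \<times> 'a) \<Rightarrow> bool" where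
  "Y_map G \<sigma> \<longleftrightarrow> is_map G \<sigma> \<and> (\<forall>e \<in> parcs G. even (length (belt \<sigma> e)) \<and> Y_belt G (belt \<sigma> e))"

definition four_periodic_belts ::
    "'a pair_pre_digraph \<Rightarrow> ('a \<times> 'a \<Rightarrow> 'a \<times> 'a) \<Rightarrow> ('a \<Rightarrow> nat) \<Rightarrow> bool" where
  "four_periodic_belts G \<sigma> f \<longleftrightarrow>
     (\<forall>e \<in> parcs G. \<exists>a b c d k. {a, b, c, d} = {0..3} \<and>
        map (\<lambda>x. f (fst x)) (belt \<sigma> e) = concat (replicate k [a, b, c, d]))"

definition Pi_map :: "'a pair_pre_digraph \<Rightarrow> ('a \<times> 'a \<Rightarrow> 'a \<times> 'a) \<Rightarrow> bool" where
  "Pi_map G \<sigma> \<longleftrightarrow> Y_map G \<sigma> \<and> (\<exists>f. eds_partition G f \<and> four_periodic_belts G \<sigma> f)"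


section \<open>Directed, reversed and periodic colourings\<close>

text \<open>
  An ETGC of a \<open>\<Pi>\<close>-map is one whose partition of the vertices into four EDSs is as in the
  definition of a \<open>\<Pi>\<close>-map. Nothing is required of the edge colours along the belts.
\<close>

definition map_ETGC ::
    "'a pair_pre_digraph \<Rightarrow> ('a \<times> 'a \<Rightarrow> 'a \<times> 'a) \<Rightarrow> 'a total_col \<Rightarrow> bool" where
  "map_ETGC G \<sigma> \<mu> \<longleftrightarrow> ETGC G \<mu> \<and> four_periodic_belts G \<sigma> (vcol \<mu>)"

text \<open>
  Edge \<open>i\<close> of a belt joins its vertices \<open>i\<close> and \<open>i + 1\<close>. So the edges at distance 1 from vertex
  \<open>j\<close> are edge \<open>j + 1\<close> in the clockwise and edge \<open>j - 2\<close> in the counterclockwise direction.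
\<close>

definition directed_belt :: "'a total_col \<Rightarrow> ('a \<times> 'a) list \<Rightarrow> bool" where
  "directed_belt \<mu> b \<longleftrightarrow>
     (\<forall>i < length b. ecol \<mu> (b ! i) = 0 \<longrightarrow>
        (\<exists>j < length b. vcol \<mu> (fst (b ! j)) = 0 \<and> i = (j + 1) mod length b))"

definition reversed_belt :: "'a total_col \<Rightarrow> ('a \<times> 'a) list \<Rightarrow> bool" where
  "reversed_belt \<mu> b \<longleftrightarrow>
     (\<forall>i < length b. ecol \<mu> (b ! i) = 0 \<longrightarrow>
        (\<exists>j < length b. vcol \<mu> (fst (b ! j)) = 0 \<and> j = (i + 2) mod length b))"

definition DETGCs :: "'a pair_pre_digraph \<Rightarrow> ('a \<times> 'a \<Rightarrow> 'a \<times> 'a) \<Rightarrow> 'a total_col set" where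
  "DETGCs G \<sigma> = {\<mu>. map_ETGC G \<sigma> \<mu> \<and> (\<forall>e \<in> parcs G. directed_belt \<mu> (belt \<sigma> e))}"

definition RETGCs :: "'a pair_pre_digraph \<Rightarrow> ('a \<times> 'a \<Rightarrow> 'a \<times> 'a) \<Rightarrow> 'a total_col set" where
  "RETGCs G \<sigma> = {\<mu>. map_ETGC G \<sigma> \<mu> \<and> (\<forall>e \<in> parcs G. reversed_belt \<mu> (belt \<sigma> e))}"

definition clockwise_colors :: "'a total_col \<Rightarrow> ('a \<times> 'a) list \<Rightarrow> nat list" where
  "clockwise_colors \<mu> b = concat (map (\<lambda>e. [vcol \<mu> (fst e), ecol \<mu> e]) b)"

definition counterclockwise_colors :: "'a total_col \<Rightarrow> ('a \<times> 'a) list \<Rightarrow> nat list" where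
  "counterclockwise_colors \<mu> b = concat (map (\<lambda>e. [vcol \<mu> (snd e), ecol \<mu> e]) (rev b))"

definition periodic_belt :: "'a total_col \<Rightarrow> ('a \<times> 'a) list \<Rightarrow> bool" where
  "periodic_belt \<mu> B \<longleftrightarrow>
     (\<exists>a b c d k. {a, b, c, d} = {0..3} \<and>
        concat (replicate k [a, b, c, a, d, c, b, d])
          \<in> {clockwise_colors \<mu> B, counterclockwise_colors \<mu> B})"

definition periodic_ETGC ::
    "'a pair_pre_digraph \<Rightarrow> ('a \<times> 'a \<Rightarrow> 'a \<times> 'a) \<Rightarrow> 'a total_col \<Rightarrow> bool" where
  "periodic_ETGC G \<sigma> \<mu> \<longleftrightarrow> ETGC G \<mu> \<and> (\<forall>e \<in> parcs G. periodic_belt \<mu> (belt \<sigma> e))"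

text \<open>
  A 3-permutation \<open>abc\<close> is the list \<open>[a, b, c]\<close>. For a periodic ETGC the description determines it
  uniquely, because vertex colours along a belt repeat after four steps.
\<close>

definition face_coloring ::
    "'a pair_pre_digraph \<Rightarrow> ('a \<times> 'a \<Rightarrow> 'a \<times> 'a) \<Rightarrow> 'a total_col \<Rightarrow> ('a \<times> 'a) set \<Rightarrow> nat list" where
  "face_coloring G \<sigma> \<mu> =
     (\<lambda>F \<in> faces G \<sigma>. THE w. \<exists>e \<in> F. vcol \<mu> (fst e) = 0 \<and>
        w = map (\<lambda>i. vcol \<mu> (fst ((face_step \<sigma> ^^ i) e))) [1, 2, 3])"

definition PFCs ::
    "'a pair_pre_digraph \<Rightarrow> ('a \<times> 'a \<Rightarrow> 'a \<times> 'a) \<Rightarrow> (('a \<times> 'a) set \<Rightarrow> nat list) set" where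
  "PFCs G \<sigma> = face_coloring G \<sigma> ` {\<mu>. periodic_ETGC G \<sigma> \<mu>}"

end

theory Submission
  imports Defs
begin

text \<open>
  Let \<open>v\<close> be a vertex of a cubic graph with an efficient total colouring. The four colours occur
  once on \<open>v\<close> and its neighbours and once on \<open>v\<close> and its edges, and no edge has the colour of its
  far end. So the edges at \<open>v\<close> are coloured by one of the two cyclic permutations of the colours
  of the neighbours: in a rotation system, each edge has either the colour of the next
  neighbour counterclockwise (it is \<^emph>\<open>leftward\<close>) or that of the next neighbour clockwise.

  If any four consecutive vertices of a face have different colours, then the face to the right of
  an arc \<open>e\<close> from \<open>v\<close> shows the colours of \<open>v\<close>, of the head of \<open>e\<close> and of the other two neighbours
  of \<open>v\<close> in counterclockwise order (\<open>belt_colors_at_vertex\<close>). Applied to both sides of an edge,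
  this shows that the edge is leftward from both ends or from neither. As the graph is connected,
  all edges are of the same kind (\<open>leftward_constant\<close>). Along a face with vertex colours
  \<open>a, b, c, d\<close>, the edge from \<open>a\<close> to \<open>b\<close> has colour \<open>c\<close> if edges are leftward, and \<open>d\<close> otherwise.
  Reading off the position of colour 0, the directed colourings are those without leftward edges,
  the reversed ones those with leftward edges only, and the periodic colourings are both kinds
  together.

  Exchanging the two possible colours of every edge (\<open>flip_edges\<close>) turns one kind into the other
  and keeps the vertex colours, hence the face colouring. The condition on 4-cycles survives
  because it holds for the edges as soon as it holds for the vertices (\<open>ETC_four_cycle\<close>). So
  directed and reversed colourings alone already induce every face colouring.

  Finally, the face colouring is injective on either kind. It determines the vertex colours up to
  a rotation of each face, and two faces with a common edge show cyclic orders that have no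
  nontrivial rotation in common (\<open>vcol_determined\<close>). The vertex colours and the kind determine the
  edge colours.
\<close>


section \<open>Four colours, lists and orbits\<close>

lemma quad_distinct:
  assumes "{a, b, c, d} = {0..3::nat}"
  shows "distinct [a, b, c, d]"
proof -
  have "card (set [a, b, c, d]) = card {0..3::nat}"
    using assms by simp
  then show ?thesis
    by (intro card_distinct) simp
qed

lemma quadI:
  assumes "distinct [a, b, c, d]" "{a, b, c, d} \<subseteq> {0..3::nat}"
  shows "{a, b, c, d} = {0..3}"
  using distinct_card[OF assms(1)] by (intro card_subset_eq[OF _ assms(2)]) auto

text \<open>
  The three edges at a vertex of colour \<open>a\<close> whose neighbours are coloured \<open>x\<close>, \<open>y\<close>, \<open>z\<close> receive
  these three colours again, each edge a colour different from that of its far end: the edge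
  colours are one of the two fixed-point free permutations of the neighbour colours.
\<close>

lemma derangement_of_three:
  assumes "{a, x, y, z} = {0..3::nat}" "{a, p, q, r} = {0..3}"
    and "p \<noteq> x" "q \<noteq> y" "r \<noteq> z"
  shows "p = y \<and> q = z \<and> r = x \<or> p = z \<and> q = x \<and> r = y"
proof -
  have "p \<in> {a, x, y, z}" "q \<in> {a, x, y, z}" "r \<in> {a, x, y, z}"
    unfolding assms(1) using assms(2) by blast+
  moreover have "distinct [a, p, q, r]"
    using assms(2) by (rule quad_distinct)
  ultimately show ?thesis
    using assms(3-5) by auto
qed

lemma quad_last:
  assumes "{a, b, c, d} = {0..3::nat}" "{a, b, c, d'} = {0..3}"
  shows "d = d'"
proof -
  have "d \<in> {a, b, c, d'}"
    unfolding assms(2) using assms(1) by blast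
  then show ?thesis
    using quad_distinct[OF assms(1)] by auto
qed

text \<open>
  A sequence in which any four consecutive terms are the four colours in some order has period 4
  and repeats no colour within a period.
\<close>

context
  fixes x :: "nat \<Rightarrow> nat"
  assumes quads: "\<And>i. {x i, x (i + 1), x (i + 2), x (i + 3)} = {0..3}"
begin

lemma rainbow_period4: "x (i + 4) = x i"
proof -
  have "{x (i + 1), x (i + 2), x (i + 3), x i} = {0..3}"
    unfolding quads[of i, symmetric] by auto
  moreover have "{x (i + 1), x (i + 2), x (i + 3), x (i + 4)} = {0..3}"
    using quads[of "i + 1"] by (simp add: eval_nat_numeral)
  ultimately show ?thesis
    using quad_last by metis
qed

lemma rainbow_mod4: "x i = x (i mod 4)"
proof -
  have "x (j + 4 * k) = x j" for j k
  proof (induction k)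
    case (Suc k)
    have "x (j + 4 * Suc k) = x ((j + 4 * k) + 4)"
      by (simp add: ac_simps)
    then show ?case
      using Suc rainbow_period4 by simp
  qed simp
  from this[of "i mod 4" "i div 4"] show ?thesis
    by simp
qed

lemma rainbow_eq_iff: "x i = x j \<longleftrightarrow> i mod 4 = j mod 4"
proof -
  have "distinct [x 0, x 1, x 2, x 3]"
    using quad_distinct[OF quads[of 0]] by (simp only: add_0)
  then have "inj_on x {0, 1, 2, 3}"
    by (auto simp: inj_on_def)
  moreover have "k mod 4 \<in> {0, 1, 2, 3}" for k :: nat
    using mod_less_divisor[of 4 k] by (simp del: mod_less_divisor) linarith
  ultimately have "x (i mod 4) = x (j mod 4) \<longleftrightarrow> i mod 4 = j mod 4"
    by (intro inj_on_eq_iff)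
  then show ?thesis
    using rainbow_mod4 by metis
qed

end

lemma periodic4_mult:
  assumes "\<And>i. h (i + 4) = h i"
  shows "h (4 * k + j) = h (j :: nat)"
proof (induction k)
  case (Suc k)
  have "h (4 * Suc k + j) = h ((4 * k + j) + 4)"
    by (simp add: ac_simps)
  then show ?case
    unfolding assms Suc .
qed simp

lemma upt_four_blocks:
  "[0..<4 * Suc k] = [0..<4 * k] @ [4 * k + 0, 4 * k + 1, 4 * k + 2, 4 * k + 3]"
proof -
  have "4 * Suc k = Suc (Suc (Suc (Suc (4 * k))))"
    by simp
  then show ?thesis
    by (simp del: mult_Suc_right)
qed

lemma concat_map_upt_periodic:
  assumes "\<And>i. h (i + 4) = h i"
  shows "concat (map h [0..<4 * k]) = concat (replicate k (h 0 @ h 1 @ h 2 @ h 3))"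
proof (induction k)
  case (Suc k)
  have "concat (replicate (Suc k) w) = concat (replicate k w) @ w" for w :: "'a list"
    by (induction k) auto
  then show ?case
    using Suc by (simp only: upt_four_blocks map_append concat_append periodic4_mult[of h, OF assms]
        list.map concat.simps append_Nil2)
qed simp

lemma concat_map_rev_upt_periodic:
  assumes "\<And>i. h (i + 4) = h i"
  shows "concat (map h (rev [0..<4 * k])) = concat (replicate k (h 3 @ h 2 @ h 1 @ h 0))"
proof (induction k)
  case (Suc k)
  have "rev [0..<4 * Suc k] = [4 * k + 3, 4 * k + 2, 4 * k + 1, 4 * k + 0] @ rev [0..<4 * k]"
    unfolding upt_four_blocks by simp
  then show ?case
    using Suc by (simp only: map_append concat_append periodic4_mult[of h, OF assms] list.map
        concat.simps append_Nil2 append_assoc replicate_Suc)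
qed simp

lemma every_other_of_periodic:
  assumes "concat (map (\<lambda>e. [p e, q e]) b) = concat (replicate k [x0, y0, x1, y1, x2, y2, x3, y3])"
  shows "map p b = concat (replicate k [x0, x1, x2, x3])"
  using assms
proof (induction k arbitrary: b)
  case (Suc k)
  from Suc.prems obtain e0 e1 e2 e3 b' where b: "b = e0 # e1 # e2 # e3 # b'"
    by (cases b; cases "tl b"; cases "tl (tl b)"; cases "tl (tl (tl b))") auto
  with Suc.prems Suc.IH[of b'] show ?case
    by simp
qed simp

lemma periodic_list_nth:
  assumes "xs = concat (replicate k [a, b, c, d])" "xs \<noteq> []"
  shows "length xs \<ge> 4" "xs ! 0 = a" "xs ! 1 = b" "xs ! 2 = c" "xs ! 3 = d" "last xs = d"
proof -
  obtain k' where k: "k = Suc k'"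
    using assms by (cases k) auto
  show "length xs \<ge> 4" "xs ! 0 = a" "xs ! 1 = b" "xs ! 2 = c" "xs ! 3 = d"
    unfolding assms(1) k by simp_all
  have "last (concat (replicate (Suc k') [a, b, c, d])) = d"
    by (induction k') simp_all
  then show "last xs = d"
    unfolding assms(1) k .
qed

lemma rev_concat_replicate: "rev (concat (replicate k w)) = concat (replicate k (rev w))"
  by (simp add: rev_concat rev_replicate map_replicate)

lemma orbit_enumeration:
  assumes "x \<in> orbit f x"
  shows "inj_on (\<lambda>i. (f ^^ i) x) {0..<card (orbit f x)}"
    and "(f ^^ card (orbit f x)) x = x"
    and "orbit f x = (\<lambda>i. (f ^^ i) x) ` {0..<card (orbit f x)}"
    and "card (orbit f x) > 0"
proof -
  have inj: "inj_on (\<lambda>i. (f ^^ i) x) {0..<funpow_dist1 f x x}"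
    by (rule inj_on_funpow_dist1[OF assms])
  have orb: "orbit f x = (\<lambda>i. (f ^^ i) x) ` {0..<funpow_dist1 f x x}"
    by (rule orbit_conv_funpow_dist1[OF assms])
  then have card: "card (orbit f x) = funpow_dist1 f x x"
    using card_image[OF inj] by simp
  show "inj_on (\<lambda>i. (f ^^ i) x) {0..<card (orbit f x)}" "(f ^^ card (orbit f x)) x = x"
    "orbit f x = (\<lambda>i. (f ^^ i) x) ` {0..<card (orbit f x)}" "card (orbit f x) > 0"
    using inj orb funpow_dist1_prop[OF assms] unfolding card by simp_all
qed


section \<open>Rotations of cubic graphs\<close>

lemma ecol_swap [simp]: "ecol \<kappa> (prod.swap e) = ecol \<kappa> e"
  by (simp add: ecol_def uedge_def insert_commute)

text \<open>A rotation system on a cubic graph; nothing is assumed about the genus.\<close>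

locale cubic_rotation = pair_graph G for G :: "'a pair_pre_digraph" +
  fixes \<sigma> :: "'a \<times> 'a \<Rightarrow> 'a \<times> 'a"
  assumes cubic: "cubic G"
    and rotation: "rotation_system G \<sigma>"
begin

lemma swap_arc: "e \<in> parcs G \<Longrightarrow> prod.swap e \<in> parcs G"
  using pair_sym_arcs by (cases e) (auto simp: symmetric_def dest: symD)

lemma sigma_permutes: "\<sigma> permutes parcs G"
  using rotation by (simp add: rotation_system_def)

lemma sigma_arc: "e \<in> parcs G \<Longrightarrow> \<sigma> e \<in> parcs G"
  using permutes_in_image[OF sigma_permutes] by blast

lemma sigma_orbit: "e \<in> parcs G \<Longrightarrow> orbit \<sigma> e = {e' \<in> parcs G. fst e' = fst e}"
  using rotation by (auto simp: rotation_system_def out_arcs_def)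

lemma out_arcs_card: "v \<in> pverts G \<Longrightarrow> card {e \<in> parcs G. fst e = v} = 3"
  using cubic by (simp add: cubic_def out_degree_def out_arcs_def)

lemma fst_sigma [simp]: "e \<in> parcs G \<Longrightarrow> fst (\<sigma> e) = fst e"
  using sigma_orbit orbit.base[of \<sigma> e] by blast

lemma sigma_star:
  assumes "e \<in> parcs G"
  shows "\<sigma> (\<sigma> (\<sigma> e)) = e"
    and "distinct [e, \<sigma> e, \<sigma> (\<sigma> e)]"
    and "{e' \<in> parcs G. fst e' = fst e} = {e, \<sigma> e, \<sigma> (\<sigma> e)}"
proof -
  have self: "e \<in> orbit \<sigma> e"
    using sigma_orbit assms by simp
  have card: "card (orbit \<sigma> e) = 3"
    using out_arcs_card assms arc_fst_in_verts sigma_orbit by simp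
  have upt: "{0..<3::nat} = {0, 1, 2}"
    by auto
  note orb = orbit_enumeration[OF self, unfolded card upt]
  show "\<sigma> (\<sigma> (\<sigma> e)) = e"
    using orb(2) by (simp add: numeral_3_eq_3)
  show "distinct [e, \<sigma> e, \<sigma> (\<sigma> e)]"
    using orb(1) by (auto simp: inj_on_def numeral_2_eq_2)
  show "{e' \<in> parcs G. fst e' = fst e} = {e, \<sigma> e, \<sigma> (\<sigma> e)}"
    using orb(3) sigma_orbit[OF assms] by (simp add: numeral_2_eq_2)
qed

lemma closed_nbhd_star:
  assumes "e \<in> parcs G"
  shows "closed_nbhd G (fst e) = {fst e, snd e, snd (\<sigma> e), snd (\<sigma> (\<sigma> e))}"
proof -
  have "{w. (fst e, w) \<in> parcs G} = snd ` {e' \<in> parcs G. fst e' = fst e}"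
    by force
  then show ?thesis
    unfolding closed_nbhd_def sigma_star(3)[OF assms] by simp
qed

lemma face_step_arc: "e \<in> parcs G \<Longrightarrow> face_step \<sigma> e \<in> parcs G"
  by (simp add: face_step_def sigma_arc swap_arc)

lemma funpow_face_step_arc: "e \<in> parcs G \<Longrightarrow> (face_step \<sigma> ^^ i) e \<in> parcs G"
  by (induction i) (auto intro: face_step_arc)

lemma fst_face_step [simp]: "e \<in> parcs G \<Longrightarrow> fst (face_step \<sigma> e) = snd e"
  by (simp add: face_step_def swap_arc)

lemma snd_funpow_face_step:
  "e \<in> parcs G \<Longrightarrow> snd ((face_step \<sigma> ^^ i) e) = fst ((face_step \<sigma> ^^ Suc i) e)"
  by (simp add: funpow_face_step_arc)

lemma face_step_sigma: "e \<in> parcs G \<Longrightarrow> face_step \<sigma> (prod.swap (\<sigma> (\<sigma> e))) = e"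
  by (simp add: face_step_def sigma_star)

lemma face_step_orbit:
  assumes "e \<in> parcs G"
  shows "e \<in> orbit (face_step \<sigma>) e"
proof -
  have inj: "inj (face_step \<sigma>)"
    using permutes_inj[OF sigma_permutes] by (auto simp: inj_def face_step_def)
  have "(\<lambda>i. (face_step \<sigma> ^^ i) e) ` UNIV \<subseteq> parcs G"
    using assms funpow_face_step_arc by blast
  then have "\<not> inj (\<lambda>i. (face_step \<sigma> ^^ i) e)"
    using pair_finite_arcs finite_imageD finite_subset infinite_UNIV_nat by blast
  then obtain i j where "i \<noteq> j" and eq: "(face_step \<sigma> ^^ i) e = (face_step \<sigma> ^^ j) e"
    unfolding inj_def by blast
  then obtain i j where "i < j" and "(face_step \<sigma> ^^ i) e = (face_step \<sigma> ^^ j) e"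
    by (cases "i < j") (auto simp: not_less_iff_gr_or_eq)
  then have "(face_step \<sigma> ^^ i) e = (face_step \<sigma> ^^ (i + (j - i))) e"
    by simp
  then have "(face_step \<sigma> ^^ i) e = (face_step \<sigma> ^^ i) ((face_step \<sigma> ^^ (j - i)) e)"
    unfolding funpow_add comp_apply .
  then have "e = (face_step \<sigma> ^^ (j - i)) e"
    using inj_fn[OF inj, of i] by (simp add: inj_eq)
  then show ?thesis
    using \<open>i < j\<close> by (auto simp: orbit_altdef)
qed

lemmas face_orbit = orbit_enumeration[OF face_step_orbit]

lemma length_belt [simp]: "length (belt \<sigma> e) = card (orbit (face_step \<sigma>) e)"
  by (simp add: belt_def)

lemma belt_nth [simp]:
  "i < card (orbit (face_step \<sigma>) e) \<Longrightarrow> belt \<sigma> e ! i = (face_step \<sigma> ^^ i) e"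
  by (simp add: belt_def)


section \<open>Vertex colours around a face\<close>

text \<open>Four consecutive vertices on the boundary of a face have four different colours.\<close>

definition rainbow_belts :: "('a \<Rightarrow> nat) \<Rightarrow> bool" where
  "rainbow_belts f \<longleftrightarrow>
     (\<forall>e \<in> parcs G. {f (fst e), f (fst (face_step \<sigma> e)), f (fst ((face_step \<sigma> ^^ 2) e)),
        f (fst ((face_step \<sigma> ^^ 3) e))} = {0..3})"

lemma rainbow_belts_shift:
  assumes "rainbow_belts f" "e \<in> parcs G"
  shows "{f (fst ((face_step \<sigma> ^^ i) e)), f (fst ((face_step \<sigma> ^^ (i + 1)) e)),
    f (fst ((face_step \<sigma> ^^ (i + 2)) e)), f (fst ((face_step \<sigma> ^^ (i + 3)) e))} = {0..3}"
proof -
  have "(face_step \<sigma> ^^ (i + j)) e = (face_step \<sigma> ^^ j) ((face_step \<sigma> ^^ i) e)" for j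
    by (simp only: add.commute[of i] funpow_add comp_apply)
  note shift = this
  have "(face_step \<sigma> ^^ (i + 1)) e = face_step \<sigma> ((face_step \<sigma> ^^ i) e)"
    by simp
  then show ?thesis
    using bspec[OF assms(1)[unfolded rainbow_belts_def] funpow_face_step_arc[OF assms(2), of i]]
    by (simp only: shift[of 2] shift[of 3])
qed

lemma rainbow_belts_period4:
  assumes "rainbow_belts f" "e \<in> parcs G"
  shows "f (fst ((face_step \<sigma> ^^ (i + 4)) e)) = f (fst ((face_step \<sigma> ^^ i) e))"
  by (rule rainbow_period4[OF rainbow_belts_shift[OF assms]])

lemma rainbow_belts_eq_iff:
  assumes "rainbow_belts f" "e \<in> parcs G"
  shows "f (fst ((face_step \<sigma> ^^ i) e)) = f (fst ((face_step \<sigma> ^^ j) e)) \<longleftrightarrow> i mod 4 = j mod 4"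
  by (rule rainbow_eq_iff[OF rainbow_belts_shift[OF assms]])

lemma rainbow_belts_length:
  assumes "rainbow_belts f" "e \<in> parcs G"
  shows "4 dvd card (orbit (face_step \<sigma>) e)" "card (orbit (face_step \<sigma>) e) \<ge> 4"
proof -
  show "4 dvd card (orbit (face_step \<sigma>) e)"
    using iffD1[OF rainbow_belts_eq_iff[OF assms], of "card (orbit (face_step \<sigma>) e)" 0]
    by (simp only: face_orbit(2)[OF assms(2)] funpow_0 dvd_eq_mod_eq_0 mod_0)
  then show "card (orbit (face_step \<sigma>) e) \<ge> 4"
    using face_orbit(4)[OF assms(2)] by (simp add: dvd_imp_le)
qed

lemma four_periodic_iff_rainbow: "four_periodic_belts G \<sigma> f \<longleftrightarrow> rainbow_belts f"
proof
  assume per: "four_periodic_belts G \<sigma> f"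
  show "rainbow_belts f"
    unfolding rainbow_belts_def
  proof
    fix e
    assume e: "e \<in> parcs G"
    from bspec[OF per[unfolded four_periodic_belts_def] e]
    obtain a b c d k where abcd: "{a, b, c, d} = {0..3}"
      and eq: "map (\<lambda>x. f (fst x)) (belt \<sigma> e) = concat (replicate k [a, b, c, d])"
      by (elim exE conjE)
    have "map (\<lambda>x. f (fst x)) (belt \<sigma> e) \<noteq> []"
      using face_orbit(4)[OF e] by (simp add: belt_def)
    note block = periodic_list_nth[OF eq this]
    have "card (orbit (face_step \<sigma>) e) \<ge> 4"
      using block(1) by simp
    then have "f (fst e) = a" "f (fst (face_step \<sigma> e)) = b" "f (fst ((face_step \<sigma> ^^ 2) e)) = c"
      "f (fst ((face_step \<sigma> ^^ 3) e)) = d"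
      using block(2-5) by simp_all
    then show "{f (fst e), f (fst (face_step \<sigma> e)), f (fst ((face_step \<sigma> ^^ 2) e)),
        f (fst ((face_step \<sigma> ^^ 3) e))} = {0..3}"
      using abcd by (simp only:)
  qed
next
  assume rb: "rainbow_belts f"
  show "four_periodic_belts G \<sigma> f"
    unfolding four_periodic_belts_def
  proof
    fix e
    assume e: "e \<in> parcs G"
    let ?x = "\<lambda>i. f (fst ((face_step \<sigma> ^^ i) e))"
    obtain k where k: "card (orbit (face_step \<sigma>) e) = 4 * k"
      using rainbow_belts_length(1)[OF rb e] by blast
    have "map (\<lambda>x. f (fst x)) (belt \<sigma> e) = concat (map (\<lambda>i. [?x i]) [0..<4 * k])"
      by (simp add: belt_def k)
    also have "\<dots> = concat (replicate k [?x 0, ?x 1, ?x 2, ?x 3])"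
      using concat_map_upt_periodic[of "\<lambda>i. [?x i]" k] rainbow_belts_period4[OF rb e] by simp
    finally have "map (\<lambda>x. f (fst x)) (belt \<sigma> e) = concat (replicate k [?x 0, ?x 1, ?x 2, ?x 3])" .
    moreover have "{?x 0, ?x 1, ?x 2, ?x 3} = {0..3}"
      using rainbow_belts_shift[OF rb e, of 0] by (simp only: add_0)
    ultimately show "\<exists>a b c d k. {a, b, c, d} = {0..3} \<and>
        map (\<lambda>x. f (fst x)) (belt \<sigma> e) = concat (replicate k [a, b, c, d])"
      by (intro exI conjI)
  qed
qed


section \<open>Efficient total colourings at a vertex\<close>

lemma ETC_vertex_star:
  assumes "ETC G \<kappa>" "e \<in> parcs G"
  shows "{vcol \<kappa> (fst e), vcol \<kappa> (snd e), vcol \<kappa> (snd (\<sigma> e)), vcol \<kappa> (snd (\<sigma> (\<sigma> e)))} = {0..3}"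
proof -
  have "vcol \<kappa> ` closed_nbhd G (fst e) = {0..3}"
    using assms arc_fst_in_verts by (auto simp: ETC_def bij_betw_def)
  then show ?thesis
    by (simp add: closed_nbhd_star[OF assms(2)])
qed

lemma ETC_ecol_range:
  assumes "ETC G \<kappa>" "e \<in> parcs G"
  shows "ecol \<kappa> e \<in> {0..3}"
proof -
  have "\<kappa> \<in> (pverts G <+> uedges G) \<rightarrow>\<^sub>E {0..3}"
    using assms(1) by (simp add: ETC_def total_coloring_def)
  moreover have "Inr (uedge e) \<in> pverts G <+> uedges G"
    using assms(2) by (auto simp: uedges_def)
  ultimately show ?thesis
    unfolding ecol_def by (rule PiE_mem)
qed

lemma ETC_ecol_ends:
  assumes "ETC G \<kappa>" "e \<in> parcs G"
  shows "ecol \<kappa> e \<noteq> vcol \<kappa> (fst e)" "ecol \<kappa> e \<noteq> vcol \<kappa> (snd e)"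
proof -
  have "\<forall>e \<in> uedges G. \<forall>v \<in> e. \<kappa> (Inl v) \<noteq> \<kappa> (Inr e)"
    using assms(1) by (simp add: ETC_def total_coloring_def)
  moreover have "uedge e \<in> uedges G" "fst e \<in> uedge e" "snd e \<in> uedge e"
    using assms(2) by (auto simp: uedges_def uedge_def)
  ultimately show "ecol \<kappa> e \<noteq> vcol \<kappa> (fst e)" "ecol \<kappa> e \<noteq> vcol \<kappa> (snd e)"
    unfolding ecol_def vcol_def by metis+
qed

lemma ETC_ecol_adjacent:
  assumes "ETC G \<kappa>" "e \<in> parcs G" "e' \<in> parcs G" "fst e = fst e'" "e \<noteq> e'"
  shows "ecol \<kappa> e \<noteq> ecol \<kappa> e'"
proof -
  have "\<forall>e \<in> uedges G. \<forall>f \<in> uedges G. e \<noteq> f \<and> e \<inter> f \<noteq> {} \<longrightarrow> \<kappa> (Inr e) \<noteq> \<kappa> (Inr f)"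
    using assms(1) by (simp add: ETC_def total_coloring_def)
  moreover have "uedge e \<in> uedges G" "uedge e' \<in> uedges G"
    using assms(2,3) by (auto simp: uedges_def)
  moreover have "uedge e \<inter> uedge e' \<noteq> {}" "uedge e \<noteq> uedge e'"
    using assms(4,5) pair_no_loops[OF assms(2)]
    by (auto simp: uedge_def doubleton_eq_iff prod_eq_iff)
  ultimately show ?thesis
    unfolding ecol_def by metis
qed

lemma ETC_edge_star:
  assumes "ETC G \<kappa>" "e \<in> parcs G"
  shows "{vcol \<kappa> (fst e), ecol \<kappa> e, ecol \<kappa> (\<sigma> e), ecol \<kappa> (\<sigma> (\<sigma> e))} = {0..3}"
proof (rule quadI)
  have arcs: "\<sigma> e \<in> parcs G" "\<sigma> (\<sigma> e) \<in> parcs G"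
    using assms(2) sigma_arc by blast+
  note dist = sigma_star(2)[OF assms(2)]
  have "ecol \<kappa> e \<noteq> ecol \<kappa> (\<sigma> e)" "ecol \<kappa> e \<noteq> ecol \<kappa> (\<sigma> (\<sigma> e))" "ecol \<kappa> (\<sigma> e) \<noteq> ecol \<kappa> (\<sigma> (\<sigma> e))"
    by (rule ETC_ecol_adjacent[OF assms(1)]; use assms(2) arcs dist in simp)+
  moreover have "vcol \<kappa> (fst e) \<noteq> ecol \<kappa> e" "vcol \<kappa> (fst e) \<noteq> ecol \<kappa> (\<sigma> e)"
    "vcol \<kappa> (fst e) \<noteq> ecol \<kappa> (\<sigma> (\<sigma> e))"
    using ETC_ecol_ends(1)[OF assms(1)] assms(2) arcs by (metis fst_sigma)+
  ultimately show "distinct [vcol \<kappa> (fst e), ecol \<kappa> e, ecol \<kappa> (\<sigma> e), ecol \<kappa> (\<sigma> (\<sigma> e))]"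
    by simp
  show "{vcol \<kappa> (fst e), ecol \<kappa> e, ecol \<kappa> (\<sigma> e), ecol \<kappa> (\<sigma> (\<sigma> e))} \<subseteq> {0..3}"
    using ETC_ecol_range[OF assms(1)] ETC_vertex_star[OF assms] assms(2) arcs by blast
qed

text \<open>
  An arc leaving \<open>v\<close> is coloured leftward if it has the colour of the neighbour of \<open>v\<close> that
  follows its head in the counterclockwise direction.
\<close>

definition leftward :: "'a total_col \<Rightarrow> 'a \<times> 'a \<Rightarrow> bool" where
  "leftward \<kappa> e \<longleftrightarrow> ecol \<kappa> e = vcol \<kappa> (snd (\<sigma> e))"

lemma ETC_star_cases:
  assumes "ETC G \<kappa>" "e \<in> parcs G"
  shows "ecol \<kappa> e = vcol \<kappa> (snd (\<sigma> e)) \<and> ecol \<kappa> (\<sigma> e) = vcol \<kappa> (snd (\<sigma> (\<sigma> e))) \<and>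
        ecol \<kappa> (\<sigma> (\<sigma> e)) = vcol \<kappa> (snd e) \<or>
      ecol \<kappa> e = vcol \<kappa> (snd (\<sigma> (\<sigma> e))) \<and> ecol \<kappa> (\<sigma> e) = vcol \<kappa> (snd e) \<and>
        ecol \<kappa> (\<sigma> (\<sigma> e)) = vcol \<kappa> (snd (\<sigma> e))"
  using ETC_ecol_ends(2)[OF assms(1)] assms(2) sigma_arc
  by (intro derangement_of_three[OF ETC_vertex_star[OF assms] ETC_edge_star[OF assms]]) auto

lemma not_leftward_iff:
  assumes "ETC G \<kappa>" "e \<in> parcs G"
  shows "\<not> leftward \<kappa> e \<longleftrightarrow> ecol \<kappa> e = vcol \<kappa> (snd (\<sigma> (\<sigma> e)))"
  using ETC_star_cases[OF assms] quad_distinct[OF ETC_vertex_star[OF assms]]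
  by (auto simp: leftward_def)

lemma leftward_sigma:
  assumes "ETC G \<kappa>" "e \<in> parcs G"
  shows "leftward \<kappa> (\<sigma> e) \<longleftrightarrow> leftward \<kappa> e"
  using ETC_star_cases[OF assms] quad_distinct[OF ETC_vertex_star[OF assms]]
  by (auto simp: leftward_def)

lemma leftward_same_tail:
  assumes "ETC G \<kappa>" "e \<in> parcs G" "e' \<in> parcs G" "fst e' = fst e"
  shows "leftward \<kappa> e' \<longleftrightarrow> leftward \<kappa> e"
proof -
  have "e' \<in> {e, \<sigma> e, \<sigma> (\<sigma> e)}"
    using assms(3,4) sigma_star(3)[OF assms(2)] by blast
  then show ?thesis
    using leftward_sigma[OF assms(1,2)] leftward_sigma[OF assms(1) sigma_arc[OF assms(2)]] by auto
qed

text \<open>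
  Two edges at a vertex never exchange the colours of their far ends, and one of them always has
  the colour of the far end of the other. No rotation system enters this statement.
\<close>

lemma ETC_turn:
  assumes "ETC G \<kappa>" "e \<in> parcs G" "e' \<in> parcs G" "fst e' = fst e" "e' \<noteq> e"
  shows "ecol \<kappa> e = vcol \<kappa> (snd e') \<longleftrightarrow> ecol \<kappa> e' \<noteq> vcol \<kappa> (snd e)"
proof -
  have "e' = \<sigma> e \<or> e' = \<sigma> (\<sigma> e)"
    using assms(3-5) sigma_star(3)[OF assms(2)] by blast
  then show ?thesis
    using ETC_star_cases[OF assms(1,2)] quad_distinct[OF ETC_vertex_star[OF assms(1,2)]]
    by auto
qed


section \<open>Edge colours around a face\<close>

text \<open>
  The four vertices that follow each other on a face, starting with an arc \<open>e\<close> from \<open>v\<close>, have the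
  colours of \<open>v\<close> and of its three neighbours in counterclockwise order, starting from the head of
  \<open>e\<close>. Indeed the face reaches \<open>v\<close> from the neighbour that precedes the head of \<open>e\<close> in this order,
  hence the vertex two steps after \<open>v\<close> must have the colour of the remaining neighbour.
\<close>

lemma belt_colors_at_vertex:
  assumes "ETC G \<kappa>" "rainbow_belts (vcol \<kappa>)" "e \<in> parcs G"
  shows "vcol \<kappa> (fst ((face_step \<sigma> ^^ 2) e)) = vcol \<kappa> (snd (\<sigma> e))"
    and "vcol \<kappa> (fst ((face_step \<sigma> ^^ 3) e)) = vcol \<kappa> (snd (\<sigma> (\<sigma> e)))"
proof -
  let ?x = "\<lambda>i. vcol \<kappa> (fst ((face_step \<sigma> ^^ i) e))"
  define g where "g = prod.swap (\<sigma> (\<sigma> e))"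
  have g: "g \<in> parcs G" "face_step \<sigma> g = e" "fst g = snd (\<sigma> (\<sigma> e))"
    unfolding g_def using assms(3) by (simp_all add: swap_arc sigma_arc face_step_sigma)
  have star: "{vcol \<kappa> (fst e), vcol \<kappa> (snd e), vcol \<kappa> (snd (\<sigma> e)), vcol \<kappa> (snd (\<sigma> (\<sigma> e)))} = {0..3}"
    by (rule ETC_vertex_star[OF assms(1,3)])
  have "{vcol \<kappa> (fst g), vcol \<kappa> (fst (face_step \<sigma> g)), vcol \<kappa> (fst ((face_step \<sigma> ^^ 2) g)),
      vcol \<kappa> (fst ((face_step \<sigma> ^^ 3) g))} = {0..3}"
    using assms(2) g(1) unfolding rainbow_belts_def by (rule bspec)
  moreover have "(face_step \<sigma> ^^ 2) g = face_step \<sigma> e" "(face_step \<sigma> ^^ 3) g = face_step \<sigma> (face_step \<sigma> e)"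
    "?x 2 = vcol \<kappa> (fst (face_step \<sigma> (face_step \<sigma> e)))"
    by (simp_all add: numeral_2_eq_2 numeral_3_eq_3 g(2))
  ultimately have "{vcol \<kappa> (snd (\<sigma> (\<sigma> e))), vcol \<kappa> (fst e), vcol \<kappa> (snd e), ?x 2} = {0..3}"
    using g assms(3) by simp
  moreover have "{vcol \<kappa> (snd (\<sigma> (\<sigma> e))), vcol \<kappa> (fst e), vcol \<kappa> (snd e), vcol \<kappa> (snd (\<sigma> e))} = {0..3}"
    unfolding star[symmetric] by blast
  ultimately show two: "?x 2 = vcol \<kappa> (snd (\<sigma> e))"
    by (rule quad_last)
  have "{vcol \<kappa> (fst e), vcol \<kappa> (snd e), ?x 2, ?x 3} = {0..3}"
    using bspec[OF assms(2)[unfolded rainbow_belts_def] assms(3)] assms(3) by simp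
  from this[unfolded two] star show "?x 3 = vcol \<kappa> (snd (\<sigma> (\<sigma> e)))"
    by (rule quad_last)
qed

lemma leftward_ecol:
  assumes "ETC G \<kappa>" "rainbow_belts (vcol \<kappa>)" "e \<in> parcs G"
  shows "leftward \<kappa> e \<longleftrightarrow> ecol \<kappa> e = vcol \<kappa> (fst ((face_step \<sigma> ^^ 2) e))"
    and "\<not> leftward \<kappa> e \<longleftrightarrow> ecol \<kappa> e = vcol \<kappa> (fst ((face_step \<sigma> ^^ 3) e))"
  using not_leftward_iff[OF assms(1,3)] belt_colors_at_vertex[OF assms]
  by (simp_all add: leftward_def)

lemma belt_ecol:
  assumes "ETC G \<kappa>" "rainbow_belts (vcol \<kappa>)" "e \<in> parcs G"
  shows "leftward \<kappa> ((face_step \<sigma> ^^ i) e) \<Longrightarrow>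
      ecol \<kappa> ((face_step \<sigma> ^^ i) e) = vcol \<kappa> (fst ((face_step \<sigma> ^^ (i + 2)) e))"
    and "\<not> leftward \<kappa> ((face_step \<sigma> ^^ i) e) \<Longrightarrow>
      ecol \<kappa> ((face_step \<sigma> ^^ i) e) = vcol \<kappa> (fst ((face_step \<sigma> ^^ (i + 3)) e))"
proof -
  have "(face_step \<sigma> ^^ (i + j)) e = (face_step \<sigma> ^^ j) ((face_step \<sigma> ^^ i) e)" for j
    by (simp only: add.commute[of i] funpow_add comp_apply)
  then show "leftward \<kappa> ((face_step \<sigma> ^^ i) e) \<Longrightarrow>
      ecol \<kappa> ((face_step \<sigma> ^^ i) e) = vcol \<kappa> (fst ((face_step \<sigma> ^^ (i + 2)) e))"
    "\<not> leftward \<kappa> ((face_step \<sigma> ^^ i) e) \<Longrightarrow>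
      ecol \<kappa> ((face_step \<sigma> ^^ i) e) = vcol \<kappa> (fst ((face_step \<sigma> ^^ (i + 3)) e))"
    using leftward_ecol[OF assms(1,2) funpow_face_step_arc[OF assms(3), of i]] by metis+
qed

lemma leftward_swap:
  assumes "ETC G \<kappa>" "rainbow_belts (vcol \<kappa>)" "e \<in> parcs G"
  shows "leftward \<kappa> (prod.swap e) \<longleftrightarrow> leftward \<kappa> e"
proof -
  have "fst ((face_step \<sigma> ^^ 2) e) = snd (\<sigma> (prod.swap e))"
    using assms(3) face_step_arc[OF assms(3)] by (simp add: numeral_2_eq_2) (simp add: face_step_def)
  then have "vcol \<kappa> (snd (\<sigma> (prod.swap e))) = vcol \<kappa> (snd (\<sigma> e))"
    using belt_colors_at_vertex(1)[OF assms] by simp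
  then show ?thesis
    by (simp add: leftward_def)
qed

end

locale connected_cubic_rotation = cubic_rotation +
  assumes connected: "connected (with_proj G)"
begin

text \<open>
  If any four consecutive vertices of a face have different colours, then either all arcs are
  leftward or none is.
\<close>

lemma leftward_constant:
  assumes "ETC G \<kappa>" "rainbow_belts (vcol \<kappa>)" "e \<in> parcs G" "e' \<in> parcs G"
  shows "leftward \<kappa> e' \<longleftrightarrow> leftward \<kappa> e"
proof -
  have "strongly_connected (with_proj G)"
    using symmetric_connected_imp_strongly_connected[OF pair_sym_arcs connected] .
  then have "fst e \<rightarrow>\<^sup>*\<^bsub>with_proj G\<^esub> fst e'"
    using assms(3,4) arc_fst_in_verts by (auto simp: strongly_connected_def)
  then have "\<forall>e'' \<in> parcs G. fst e'' = fst e' \<longrightarrow> (leftward \<kappa> e'' \<longleftrightarrow> leftward \<kappa> e)"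
  proof (induction rule: reachable_induct)
    case base
    then show ?case
      using leftward_same_tail[OF assms(1,3)] by blast
  next
    case (step v w)
    then have vw: "(v, w) \<in> parcs G"
      by simp
    then have wv: "(w, v) \<in> parcs G"
      using swap_arc by fastforce
    have "leftward \<kappa> (v, w) \<longleftrightarrow> leftward \<kappa> e"
      using step vw by simp
    moreover have "leftward \<kappa> (w, v) \<longleftrightarrow> leftward \<kappa> (v, w)"
      using leftward_swap[OF assms(1,2) vw] by simp
    ultimately show ?case
      using leftward_same_tail[OF assms(1) wv] by simp
  qed
  then show ?thesis
    using assms(4) by blast
qed

end


section \<open>Exchanging the two edge colourings\<close>

text \<open>
  At every edge exactly two colours are not used by the ends. Recolouring each edge with the
  other one of these two is an involution that keeps the vertex colours; 6 is the sum of all four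
  colours. The value outside the graph keeps the colouring extensional.
\<close>

definition flip_edges :: "'a pair_pre_digraph \<Rightarrow> 'a total_col \<Rightarrow> 'a total_col" where
  "flip_edges G \<mu> = (\<lambda>x. case x of
     Inl v \<Rightarrow> \<mu> (Inl v)
   | Inr e \<Rightarrow> if e \<in> uedges G then 6 - (\<Sum>v\<in>e. \<mu> (Inl v)) - \<mu> (Inr e) else undefined)"

lemma vcol_flip_edges [simp]: "vcol (flip_edges G \<mu>) = vcol \<mu>"
  by (simp add: fun_eq_iff vcol_def flip_edges_def)

lemma face_coloring_flip_edges [simp]:
  "face_coloring G \<sigma> (flip_edges G \<mu>) = face_coloring G \<sigma> \<mu>"
  by (simp add: face_coloring_def)

lemma quad_sum:
  assumes "{a, b, c, d} = {0..3::nat}"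
  shows "a + b + c + d = 6"
proof -
  have "a + b + c + d = \<Sum>{a, b, c, d}"
    using quad_distinct[OF assms] by simp
  also have "\<dots> = 6"
    unfolding assms by (simp add: eval_nat_numeral)
  finally show ?thesis .
qed

context cubic_rotation
begin

lemma ecol_flip_edges:
  assumes "e \<in> parcs G"
  shows "ecol (flip_edges G \<kappa>) e = 6 - (vcol \<kappa> (fst e) + vcol \<kappa> (snd e)) - ecol \<kappa> e"
proof -
  have "(\<Sum>v\<in>uedge e. \<kappa> (Inl v)) = vcol \<kappa> (fst e) + vcol \<kappa> (snd e)"
    using pair_no_loops[OF assms] by (simp add: uedge_def vcol_def)
  then show ?thesis
    using assms by (simp add: ecol_def flip_edges_def uedges_def)
qed

lemma ecol_flip_edges_cases:
  assumes "ETC G \<kappa>" "e \<in> parcs G"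
  shows "leftward \<kappa> e \<Longrightarrow> ecol (flip_edges G \<kappa>) e = vcol \<kappa> (snd (\<sigma> (\<sigma> e)))"
    and "\<not> leftward \<kappa> e \<Longrightarrow> ecol (flip_edges G \<kappa>) e = vcol \<kappa> (snd (\<sigma> e))"
proof -
  note sum = quad_sum[OF ETC_vertex_star[OF assms]]
  show "leftward \<kappa> e \<Longrightarrow> ecol (flip_edges G \<kappa>) e = vcol \<kappa> (snd (\<sigma> (\<sigma> e)))"
    unfolding leftward_def ecol_flip_edges[OF assms(2)] using sum by linarith
  show "\<not> leftward \<kappa> e \<Longrightarrow> ecol (flip_edges G \<kappa>) e = vcol \<kappa> (snd (\<sigma> e))"
    unfolding not_leftward_iff[OF assms] ecol_flip_edges[OF assms(2)] using sum by linarith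
qed

lemma leftward_flip_edges:
  assumes "ETC G \<kappa>" "e \<in> parcs G"
  shows "leftward (flip_edges G \<kappa>) e \<longleftrightarrow> \<not> leftward \<kappa> e"
  using ecol_flip_edges_cases[OF assms] quad_distinct[OF ETC_vertex_star[OF assms]]
  by (auto simp: leftward_def[of "flip_edges G \<kappa>"])

lemma uedge_arc_from:
  assumes "d \<in> uedges G" "v \<in> d"
  obtains e where "e \<in> parcs G" "uedge e = d" "fst e = v"
proof -
  obtain e where e: "e \<in> parcs G" "d = uedge e"
    using assms(1) by (auto simp: uedges_def)
  show thesis
  proof (cases "v = fst e")
    case True
    then show thesis
      using that e by blast
  next
    case False
    then have "fst (prod.swap e) = v" "uedge (prod.swap e) = d"
      using assms(2) e(2) by (auto simp: uedge_def)
    then show thesis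
      using that swap_arc[OF e(1)] by blast
  qed
qed

lemma ETC_flip_edges:
  assumes "ETC G \<kappa>"
  shows "ETC G (flip_edges G \<kappa>)"
proof -
  let ?\<kappa> = "flip_edges G \<kappa>"
  have tc: "total_coloring G \<kappa>"
    using assms by (simp add: ETC_def)
  have star: "{vcol \<kappa> (fst e), vcol \<kappa> (snd e), vcol \<kappa> (snd (\<sigma> e)), vcol \<kappa> (snd (\<sigma> (\<sigma> e)))} = {0..3}"
    if "e \<in> parcs G" for e
    using ETC_vertex_star[OF assms that] .
  have col: "ecol ?\<kappa> e = vcol \<kappa> (snd (\<sigma> e)) \<or> ecol ?\<kappa> e = vcol \<kappa> (snd (\<sigma> (\<sigma> e)))"
    if "e \<in> parcs G" for e
    using ecol_flip_edges_cases[OF assms that] by blast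
  have range: "ecol ?\<kappa> e \<in> {0..3}" if "e \<in> parcs G" for e
    unfolding star[OF that, symmetric] using col[OF that] by blast
  have ends: "ecol ?\<kappa> e \<noteq> vcol \<kappa> (fst e)" if "e \<in> parcs G" for e
    using col[OF that] quad_distinct[OF star[OF that]] by auto
  have adjacent: "ecol ?\<kappa> e \<noteq> ecol ?\<kappa> e'"
    if "e \<in> parcs G" "e' \<in> parcs G" "fst e' = fst e" "e' \<noteq> e" for e e'
  proof -
    have "e' = \<sigma> e \<or> e' = \<sigma> (\<sigma> e)"
      using that(2-4) sigma_star(3)[OF that(1)] by blast
    moreover have "leftward \<kappa> e' \<longleftrightarrow> leftward \<kappa> e"
      using leftward_same_tail[OF assms that(1-3)] .
    ultimately show ?thesis
      using ecol_flip_edges_cases[OF assms that(1)] ecol_flip_edges_cases[OF assms that(2)]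
        quad_distinct[OF star[OF that(1)]] sigma_star(1)[OF that(1)]
      by (cases "leftward \<kappa> e") auto
  qed
  have "?\<kappa> \<in> (pverts G <+> uedges G) \<rightarrow>\<^sub>E {0..3}"
  proof (rule PiE_I)
    fix x
    assume "x \<in> pverts G <+> uedges G"
    then show "?\<kappa> x \<in> {0..3}"
    proof (rule PlusE)
      fix v
      assume v: "v \<in> pverts G" "x = Inl v"
      have "\<kappa> \<in> (pverts G <+> uedges G) \<rightarrow>\<^sub>E {0..3}"
        using tc by (simp add: total_coloring_def)
      moreover have "Inl v \<in> pverts G <+> uedges G"
        using v(1) by blast
      ultimately have "\<kappa> (Inl v) \<in> {0..3}"
        by (rule PiE_mem)
      then show "?\<kappa> x \<in> {0..3}"
        by (simp add: v(2) flip_edges_def)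
    next
      fix d
      assume d: "d \<in> uedges G" "x = Inr d"
      then obtain e where "e \<in> parcs G" "d = uedge e"
        by (auto simp: uedges_def)
      then show "?\<kappa> x \<in> {0..3}"
        using range d(2) by (simp add: ecol_def)
    qed
  next
    fix x
    assume x: "x \<notin> pverts G <+> uedges G"
    then have "\<kappa> x = undefined"
      using tc by (auto simp: total_coloring_def PiE_def extensional_def)
    with x show "?\<kappa> x = undefined"
      by (cases x) (auto simp: flip_edges_def)
  qed
  moreover have "\<forall>d \<in> uedges G. \<forall>v \<in> d. ?\<kappa> (Inl v) \<noteq> ?\<kappa> (Inr d)"
  proof (intro ballI)
    fix d v
    assume "d \<in> uedges G" "v \<in> d"
    then obtain e where "e \<in> parcs G" "uedge e = d" "fst e = v"
      by (rule uedge_arc_from)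
    then show "?\<kappa> (Inl v) \<noteq> ?\<kappa> (Inr d)"
      using ends[of e] by (auto simp: ecol_def vcol_def flip_edges_def[of G \<kappa>] split: if_splits)
  qed
  moreover have "\<forall>d \<in> uedges G. \<forall>d' \<in> uedges G. d \<noteq> d' \<and> d \<inter> d' \<noteq> {} \<longrightarrow>
      ?\<kappa> (Inr d) \<noteq> ?\<kappa> (Inr d')"
  proof (intro ballI impI, elim conjE)
    fix d d'
    assume d: "d \<in> uedges G" "d' \<in> uedges G" "d \<noteq> d'" "d \<inter> d' \<noteq> {}"
    then obtain v where v: "v \<in> d" "v \<in> d'"
      by blast
    obtain e where e: "e \<in> parcs G" "uedge e = d" "fst e = v"
      using uedge_arc_from[OF d(1) v(1)] .
    obtain e' where e': "e' \<in> parcs G" "uedge e' = d'" "fst e' = v"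
      using uedge_arc_from[OF d(2) v(2)] .
    have "ecol ?\<kappa> e \<noteq> ecol ?\<kappa> e'"
      using adjacent e e' d(3) by metis
    then show "?\<kappa> (Inr d) \<noteq> ?\<kappa> (Inr d')"
      using e(2) e'(2) by (simp add: ecol_def)
  qed
  ultimately have "total_coloring G ?\<kappa>"
    using tc by (simp add: total_coloring_def)
  then show ?thesis
    using assms by (simp add: ETC_def)
qed

text \<open>
  On a 4-cycle with four different vertex colours the edges get four different colours
  automatically. Each edge has the colour of one of the two vertices opposite to it. By
  \<open>ETC_turn\<close> at the vertices of the cycle, either every edge has the colour of the vertex that
  follows it on the cycle, or every edge has the colour of the vertex that precedes it.
\<close>

lemma ETC_four_cycle:
  assumes etc: "ETC G \<kappa>" and cyc: "graph_cycle G p" "length p = 4"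
    and vert: "bij_betw (\<lambda>e. vcol \<kappa> (fst e)) (set p) {0..3}"
  shows "bij_betw (ecol \<kappa>) (set p) {0..3}"
proof -
  obtain e0 e1 e2 e3 where p: "p = [e0, e1, e2, e3]"
    using cyc(2) by (auto simp: length_Suc_conv eval_nat_numeral)
  obtain u where awalk: "awalk u p u" and dist: "distinct (tl (pawalk_verts u p))"
    using cyc(1) by (auto simp: graph_cycle_def cycle_def)
  have arcs: "e0 \<in> parcs G" "e1 \<in> parcs G" "e2 \<in> parcs G" "e3 \<in> parcs G"
    and ends: "snd e0 = fst e1" "snd e1 = fst e2" "snd e2 = fst e3" "snd e3 = fst e0"
    using awalk by (auto simp: p awalk_def)
  have verts: "distinct [fst e1, fst e2, fst e3, fst e0]"
    using dist ends by (simp add: p)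
  let ?c = "\<lambda>e. vcol \<kappa> (fst e)"
  have colors: "{?c e0, ?c e1, ?c e2, ?c e3} = {0..3}"
    using vert by (simp add: p bij_betw_def)
  have turn: "ecol \<kappa> e = vcol \<kappa> (snd e') \<longleftrightarrow> ecol \<kappa> e' \<noteq> vcol \<kappa> (fst e)"
    if "e \<in> parcs G" "e' \<in> parcs G" "snd e = fst e'" "fst e \<noteq> snd e'" for e e'
  proof -
    have "e' \<noteq> prod.swap e"
      using that(4) by auto
    then show ?thesis
      using ETC_turn[OF etc swap_arc[OF that(1)] that(2)] that(3) by simp
  qed
  have turns: "ecol \<kappa> e0 = ?c e2 \<longleftrightarrow> ecol \<kappa> e1 \<noteq> ?c e0" "ecol \<kappa> e1 = ?c e3 \<longleftrightarrow> ecol \<kappa> e2 \<noteq> ?c e1"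
    "ecol \<kappa> e2 = ?c e0 \<longleftrightarrow> ecol \<kappa> e3 \<noteq> ?c e2"
    using turn[of e0 e1] turn[of e1 e2] turn[of e2 e3] arcs ends verts by auto
  have opposite: "ecol \<kappa> e0 = ?c e2 \<or> ecol \<kappa> e0 = ?c e3" "ecol \<kappa> e1 = ?c e3 \<or> ecol \<kappa> e1 = ?c e0"
    "ecol \<kappa> e2 = ?c e0 \<or> ecol \<kappa> e2 = ?c e1" "ecol \<kappa> e3 = ?c e1 \<or> ecol \<kappa> e3 = ?c e2"
    using ETC_ecol_range[OF etc, folded colors] ETC_ecol_ends[OF etc] arcs ends
    by (metis insertE singletonD)+
  have dist: "?c e3 \<noteq> ?c e0" "?c e0 \<noteq> ?c e1"
    using quad_distinct[OF colors] by auto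
  have "{ecol \<kappa> e0, ecol \<kappa> e1, ecol \<kappa> e2, ecol \<kappa> e3} = {?c e0, ?c e1, ?c e2, ?c e3}"
  proof (cases "ecol \<kappa> e0 = ?c e2")
    case True
    then have "ecol \<kappa> e1 = ?c e3" "ecol \<kappa> e2 = ?c e0" "ecol \<kappa> e3 = ?c e1"
      using turns opposite by blast+
    with True show ?thesis
      by (simp add: insert_commute)
  next
    case False
    then have "ecol \<kappa> e0 = ?c e3" "ecol \<kappa> e1 = ?c e0"
      using turns(1) opposite(1) by blast+
    moreover from this have "ecol \<kappa> e2 = ?c e1"
      using turns(2) dist(1) by metis
    moreover from this have "ecol \<kappa> e3 = ?c e2"
      using turns(3) dist(2) by metis
    ultimately show ?thesis
      by (simp add: insert_commute)
  qed
  then have image: "ecol \<kappa> ` set p = {0..3}"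
    by (simp add: p colors)
  have "card (set p) = card {0..3::nat}"
    using bij_betw_same_card[OF vert] .
  then have "inj_on (ecol \<kappa>) (set p)"
    by (intro eq_card_imp_inj_on) (simp_all add: image)
  then show ?thesis
    using image by (simp add: bij_betw_def)
qed

lemma ETGC_flip_edges:
  assumes "ETGC G \<kappa>"
  shows "ETGC G (flip_edges G \<kappa>)"
  using assms ETC_flip_edges[of \<kappa>] ETC_four_cycle[of "flip_edges G \<kappa>"] by (simp add: ETGC_def)

end


section \<open>Periodic, directed and reversed colourings\<close>

context cubic_rotation
begin

lemma periodic_belt_rainbow:
  assumes "e \<in> parcs G" "periodic_belt \<kappa> (belt \<sigma> e)"
  shows "{vcol \<kappa> (fst e), vcol \<kappa> (fst (face_step \<sigma> e)), vcol \<kappa> (fst ((face_step \<sigma> ^^ 2) e)),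
    vcol \<kappa> (fst ((face_step \<sigma> ^^ 3) e))} = {0..3}"
proof -
  let ?n = "card (orbit (face_step \<sigma>) e)"
  let ?b = "belt \<sigma> e"
  have ne: "?b \<noteq> []"
    using face_orbit(4)[OF assms(1)] by (simp add: belt_def)
  obtain a b c d k where abcd: "{a, b, c, d} = {0..3}"
    and "concat (replicate k [a, b, c, a, d, c, b, d]) \<in>
      {clockwise_colors \<kappa> ?b, counterclockwise_colors \<kappa> ?b}"
    using assms(2) unfolding periodic_belt_def by (elim exE conjE)
  then consider (cw) "clockwise_colors \<kappa> ?b = concat (replicate k [a, b, c, a, d, c, b, d])"
    | (ccw) "counterclockwise_colors \<kappa> ?b = concat (replicate k [a, b, c, a, d, c, b, d])"
    by (metis insertE singletonD)
  then show ?thesis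
  proof cases
    case cw
    have eq: "map (\<lambda>e. vcol \<kappa> (fst e)) ?b = concat (replicate k [a, c, d, b])"
      using every_other_of_periodic[OF cw[unfolded clockwise_colors_def]] .
    note block = periodic_list_nth[OF eq]
    have "?n \<ge> 4"
      using block(1) ne by simp
    then have "vcol \<kappa> (fst e) = a" "vcol \<kappa> (fst (face_step \<sigma> e)) = c"
      "vcol \<kappa> (fst ((face_step \<sigma> ^^ 2) e)) = d" "vcol \<kappa> (fst ((face_step \<sigma> ^^ 3) e)) = b"
      using block(2-5) ne by simp_all
    then show ?thesis
      unfolding abcd[symmetric] by auto
  next
    case ccw
    have "map (\<lambda>e. vcol \<kappa> (snd e)) (rev ?b) = concat (replicate k [a, c, d, b])"
      using every_other_of_periodic[OF ccw[unfolded counterclockwise_colors_def]] .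
    then have eq: "map (\<lambda>e. vcol \<kappa> (snd e)) ?b = concat (replicate k [b, d, c, a])"
      by (metis (no_types, lifting) append_Cons append_Nil rev.simps rev_concat_replicate rev_map
          rev_rev_ident)
    note block = periodic_list_nth[OF eq]
    have n: "?n \<ge> 4"
      using block(1) ne by simp
    \<comment> \<open>The head of the last arc of the belt is the tail of \<open>e\<close>.\<close>
    have "a = vcol \<kappa> (snd (?b ! (?n - 1)))"
      using block(6) ne n by (simp add: last_map last_conv_nth del: belt_nth)
    also have "snd (?b ! (?n - 1)) = fst ((face_step \<sigma> ^^ ?n) e)"
      using n snd_funpow_face_step[OF assms(1), of "?n - 1"] by simp
    also have "\<dots> = fst e"
      by (simp only: face_orbit(2)[OF assms(1)])
    finally have "vcol \<kappa> (fst e) = a"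
      by simp
    moreover have "vcol \<kappa> (snd ((face_step \<sigma> ^^ 0) e)) = b" "vcol \<kappa> (snd ((face_step \<sigma> ^^ 1) e)) = d"
      "vcol \<kappa> (snd ((face_step \<sigma> ^^ 2) e)) = c"
      using block(2-4) ne n by simp_all
    then have "vcol \<kappa> (fst (face_step \<sigma> e)) = b" "vcol \<kappa> (fst ((face_step \<sigma> ^^ 2) e)) = d"
      "vcol \<kappa> (fst ((face_step \<sigma> ^^ 3) e)) = c"
      unfolding snd_funpow_face_step[OF assms(1)] by (simp_all add: eval_nat_numeral)
    ultimately show ?thesis
      unfolding abcd[symmetric] by auto
  qed
qed

lemma periodic_ETGC_rainbow:
  "periodic_ETGC G \<sigma> \<kappa> \<Longrightarrow> rainbow_belts (vcol \<kappa>)"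
  unfolding periodic_ETGC_def rainbow_belts_def using periodic_belt_rainbow by blast

lemma periodic_belt_of_constant:
  assumes etc: "ETC G \<kappa>" and rb: "rainbow_belts (vcol \<kappa>)" and e: "e \<in> parcs G"
    and const: "(\<forall>e \<in> parcs G. \<not> leftward \<kappa> e) \<or> (\<forall>e \<in> parcs G. leftward \<kappa> e)"
  shows "periodic_belt \<kappa> (belt \<sigma> e)"
proof -
  let ?x = "\<lambda>i. vcol \<kappa> (fst ((face_step \<sigma> ^^ i) e))"
  let ?y = "\<lambda>i. ecol \<kappa> ((face_step \<sigma> ^^ i) e)"
  note per = rainbow_belts_period4[OF rb e]
  have quad: "{?x 0, ?x 1, ?x 2, ?x 3} = {0..3}"
    using rainbow_belts_shift[OF rb e, of 0] by (simp only: add_0)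
  obtain k where k: "card (orbit (face_step \<sigma>) e) = 4 * k"
    using rainbow_belts_length(1)[OF rb e] by blast
  from const show ?thesis
  proof
    assume "\<forall>e \<in> parcs G. \<not> leftward \<kappa> e"
    then have y: "?y i = ?x (i + 3)" for i
      using belt_ecol(2)[OF etc rb e] funpow_face_step_arc[OF e, of i] by blast
    have "clockwise_colors \<kappa> (belt \<sigma> e) = concat (map (\<lambda>i. [?x i, ?x (i + 3)]) [0..<4 * k])"
      unfolding clockwise_colors_def belt_def map_map comp_def k y ..
    also have "\<dots> = concat (replicate k ([?x 0, ?x (0 + 3)] @ [?x 1, ?x (1 + 3)] @
        [?x 2, ?x (2 + 3)] @ [?x 3, ?x (3 + 3)]))"
    proof (rule concat_map_upt_periodic)
      show "[?x (i + 4), ?x (i + 4 + 3)] = [?x i, ?x (i + 3)]" for i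
        using per[of i] per[of "i + 3"] by (simp only: ac_simps)
    qed
    also have "\<dots> = concat (replicate k [?x 0, ?x 3, ?x 1, ?x 0, ?x 2, ?x 1, ?x 3, ?x 2])"
      using per[of 0] per[of 1] per[of 2] by simp
    finally have eq: "clockwise_colors \<kappa> (belt \<sigma> e) =
      concat (replicate k [?x 0, ?x 3, ?x 1, ?x 0, ?x 2, ?x 1, ?x 3, ?x 2])" .
    have "{?x 0, ?x 3, ?x 1, ?x 2} = {0..3}"
      unfolding quad[symmetric] by blast
    then show ?thesis
      unfolding periodic_belt_def eq by (intro exI conjI) (assumption, rule insertI1)
  next
    assume "\<forall>e \<in> parcs G. leftward \<kappa> e"
    then have y: "?y i = ?x (i + 2)" for i
      using belt_ecol(1)[OF etc rb e] funpow_face_step_arc[OF e, of i] by blast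
    have head: "vcol \<kappa> (snd ((face_step \<sigma> ^^ i) e)) = ?x (i + 1)" for i
      using snd_funpow_face_step[OF e, of i] by simp
    have "counterclockwise_colors \<kappa> (belt \<sigma> e) =
        concat (map (\<lambda>i. [?x (i + 1), ?x (i + 2)]) (rev [0..<4 * k]))"
      unfolding counterclockwise_colors_def belt_def rev_map map_map comp_def k y head ..
    also have "\<dots> = concat (replicate k ([?x (3 + 1), ?x (3 + 2)] @ [?x (2 + 1), ?x (2 + 2)] @
        [?x (1 + 1), ?x (1 + 2)] @ [?x (0 + 1), ?x (0 + 2)]))"
    proof (rule concat_map_rev_upt_periodic)
      show "[?x (i + 4 + 1), ?x (i + 4 + 2)] = [?x (i + 1), ?x (i + 2)]" for i
        using per[of "i + 1"] per[of "i + 2"] by (simp only: ac_simps)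
    qed
    also have "\<dots> = concat (replicate k [?x 0, ?x 1, ?x 3, ?x 0, ?x 2, ?x 3, ?x 1, ?x 2])"
      using per[of 0] per[of 1] by (simp add: eval_nat_numeral)
    finally have eq: "counterclockwise_colors \<kappa> (belt \<sigma> e) =
      concat (replicate k [?x 0, ?x 1, ?x 3, ?x 0, ?x 2, ?x 3, ?x 1, ?x 2])" .
    have "{?x 0, ?x 1, ?x 3, ?x 2} = {0..3}"
      unfolding quad[symmetric] by blast
    then show ?thesis
      unfolding periodic_belt_def eq by (intro exI conjI) (assumption, rule insertI2, rule insertI1)
  qed
qed

lemma belt_zero:
  assumes "rainbow_belts f" "e \<in> parcs G"
  obtains i where "f (fst ((face_step \<sigma> ^^ i) e)) = 0"
proof -
  have "0 \<in> {f (fst ((face_step \<sigma> ^^ 0) e)), f (fst ((face_step \<sigma> ^^ (0 + 1)) e)),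
      f (fst ((face_step \<sigma> ^^ (0 + 2)) e)), f (fst ((face_step \<sigma> ^^ (0 + 3)) e))}"
    unfolding rainbow_belts_shift[OF assms] by simp
  then show thesis
    using that by (elim insertE emptyE) (metis+)
qed

lemma directed_belt_of_not_leftward:
  assumes etc: "ETC G \<kappa>" and rb: "rainbow_belts (vcol \<kappa>)" and e: "e \<in> parcs G"
    and right: "\<forall>e \<in> parcs G. \<not> leftward \<kappa> e"
  shows "directed_belt \<kappa> (belt \<sigma> e)"
  unfolding directed_belt_def length_belt
proof (intro allI impI)
  let ?n = "card (orbit (face_step \<sigma>) e)"
  let ?x = "\<lambda>i. vcol \<kappa> (fst ((face_step \<sigma> ^^ i) e))"
  fix i
  assume i: "i < ?n" and zero: "ecol \<kappa> (belt \<sigma> e ! i) = 0"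
  obtain k where k: "?n = 4 * Suc k"
    using rainbow_belts_length[OF rb e] by (metis dvdE mult_0_right not_numeral_le_zero old.nat.exhaust)
  have "?x (i + 3) = 0"
    using belt_ecol(2)[OF etc rb e, of i] right zero i funpow_face_step_arc[OF e, of i] by simp
  define j where "j = (i + (?n - 1)) mod ?n"
  have j: "j < ?n"
    using k by (simp add: j_def)
  have "j mod 4 = (i + (?n - 1)) mod 4"
    unfolding j_def k by (rule mod_mod_cancel) simp
  also have "i + (?n - 1) = (i + 3) + 4 * k"
    using k by simp
  also have "\<dots> mod 4 = (i + 3) mod 4"
    by (rule mod_mult_self2)
  finally have "j mod 4 = (i + 3) mod 4" .
  then have "?x j = 0"
    using rainbow_belts_eq_iff[OF rb e, of j "i + 3"] \<open>?x (i + 3) = 0\<close> by simp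
  moreover have "(j + 1) mod ?n = i"
  proof -
    have "(j + 1) mod ?n = (i + (?n - 1) + 1) mod ?n"
      unfolding j_def by (rule mod_add_left_eq)
    also have "i + (?n - 1) + 1 = i + ?n"
      using k by simp
    finally show ?thesis
      using i by simp
  qed
  ultimately show "\<exists>j<?n. vcol \<kappa> (fst (belt \<sigma> e ! j)) = 0 \<and> i = (j + 1) mod ?n"
    using j by (intro exI[of _ j]) simp
qed

lemma reversed_belt_of_leftward:
  assumes etc: "ETC G \<kappa>" and rb: "rainbow_belts (vcol \<kappa>)" and e: "e \<in> parcs G"
    and left: "\<forall>e \<in> parcs G. leftward \<kappa> e"
  shows "reversed_belt \<kappa> (belt \<sigma> e)"
  unfolding reversed_belt_def length_belt
proof (intro allI impI)
  let ?n = "card (orbit (face_step \<sigma>) e)"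
  let ?x = "\<lambda>i. vcol \<kappa> (fst ((face_step \<sigma> ^^ i) e))"
  fix i
  assume i: "i < ?n" and zero: "ecol \<kappa> (belt \<sigma> e ! i) = 0"
  have "?x (i + 2) = 0"
    using belt_ecol(1)[OF etc rb e, of i] left zero i funpow_face_step_arc[OF e, of i] by simp
  define j where "j = (i + 2) mod ?n"
  have j: "j < ?n"
    using i by (simp add: j_def)
  have "j mod 4 = (i + 2) mod 4"
    using rainbow_belts_length(1)[OF rb e] by (simp add: j_def mod_mod_cancel)
  then have "?x j = 0"
    using rainbow_belts_eq_iff[OF rb e, of j "i + 2"] \<open>?x (i + 2) = 0\<close> by simp
  then show "\<exists>j<?n. vcol \<kappa> (fst (belt \<sigma> e ! j)) = 0 \<and> j = (i + 2) mod ?n"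
    using j by (intro exI[of _ j]) (simp add: j_def)
qed

end

context connected_cubic_rotation
begin

lemma not_leftward_of_directed_belts:
  assumes etc: "ETC G \<kappa>" and rb: "rainbow_belts (vcol \<kappa>)" and e: "e \<in> parcs G"
    and dir: "\<forall>e \<in> parcs G. directed_belt \<kappa> (belt \<sigma> e)"
  shows "\<not> leftward \<kappa> e"
proof -
  obtain i where "vcol \<kappa> (fst ((face_step \<sigma> ^^ i) e)) = 0"
    using belt_zero[OF rb e] .
  then obtain g where g: "g \<in> parcs G" "vcol \<kappa> (fst g) = 0"
    using funpow_face_step_arc[OF e] by blast
  \<comment> \<open>The edge at distance 2 from the vertex of colour 0 does not have colour 0, so it is not
    coloured like the vertex two steps after its tail.\<close>
  define h where "h = face_step \<sigma> g"
  let ?x = "\<lambda>i. vcol \<kappa> (fst ((face_step \<sigma> ^^ i) g))"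
  have h: "h \<in> parcs G" "face_step \<sigma> h \<in> parcs G"
    using g(1) face_step_arc by (simp_all add: h_def)
  have "vcol \<kappa> (fst h) \<noteq> 0"
    using rainbow_belts_eq_iff[OF rb g(1), of 1 0] g(2) by (simp add: h_def)
  have n: "card (orbit (face_step \<sigma>) h) \<ge> 4"
    by (rule rainbow_belts_length(2)[OF rb h(1)])
  have "ecol \<kappa> (face_step \<sigma> h) \<noteq> 0"
  proof
    assume "ecol \<kappa> (face_step \<sigma> h) = 0"
    then have "ecol \<kappa> (belt \<sigma> h ! 1) = 0"
      using n by simp
    then obtain j where j: "j < card (orbit (face_step \<sigma>) h)" "vcol \<kappa> (fst (belt \<sigma> h ! j)) = 0"
      "1 = (j + 1) mod card (orbit (face_step \<sigma>) h)"
      using bspec[OF dir h(1)] n unfolding directed_belt_def length_belt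
      by (meson less_le_trans one_less_numeral_iff semiring_norm(76))
    have "j + 1 \<noteq> card (orbit (face_step \<sigma>) h)"
    proof
      assume eq: "j + 1 = card (orbit (face_step \<sigma>) h)"
      show False
        using j(3) unfolding eq by simp
    qed
    then have "j + 1 < card (orbit (face_step \<sigma>) h)"
      using j(1) by linarith
    then have "j = 0"
      using j(3) by simp
    then show False
      using j(1,2) \<open>vcol \<kappa> (fst h) \<noteq> 0\<close> by simp
  qed
  moreover have "vcol \<kappa> (fst ((face_step \<sigma> ^^ 2) (face_step \<sigma> h))) = 0"
    using rainbow_belts_period4[OF rb g(1), of 0] g(2) by (simp add: h_def eval_nat_numeral)
  ultimately have "\<not> leftward \<kappa> (face_step \<sigma> h)"
    using leftward_ecol(1)[OF etc rb h(2)] by simp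
  then show ?thesis
    using leftward_constant[OF etc rb e h(2)] by simp
qed

lemma leftward_of_reversed_belts:
  assumes etc: "ETC G \<kappa>" and rb: "rainbow_belts (vcol \<kappa>)" and e: "e \<in> parcs G"
    and rev: "\<forall>e \<in> parcs G. reversed_belt \<kappa> (belt \<sigma> e)"
  shows "leftward \<kappa> e"
proof -
  obtain i where "vcol \<kappa> (fst ((face_step \<sigma> ^^ i) e)) = 0"
    using belt_zero[OF rb e] .
  then obtain g where g: "g \<in> parcs G" "vcol \<kappa> (fst g) = 0"
    using funpow_face_step_arc[OF e] by blast
  define h where "h = face_step \<sigma> g"
  have h: "h \<in> parcs G"
    using g(1) face_step_arc by (simp add: h_def)
  have n: "card (orbit (face_step \<sigma>) h) \<ge> 4"
    by (rule rainbow_belts_length(2)[OF rb h])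
  have steps: "(face_step \<sigma> ^^ 2) h = (face_step \<sigma> ^^ 3) g" "(face_step \<sigma> ^^ 3) h = (face_step \<sigma> ^^ 4) g"
    by (simp_all add: h_def eval_nat_numeral)
  have "vcol \<kappa> (fst ((face_step \<sigma> ^^ 2) h)) \<noteq> 0"
    unfolding steps using rainbow_belts_eq_iff[OF rb g(1), of 3 0] g(2) by simp
  moreover have "vcol \<kappa> (fst ((face_step \<sigma> ^^ 2) h)) = 0" if "ecol \<kappa> h = 0"
  proof -
    have "ecol \<kappa> (belt \<sigma> h ! 0) = 0" "0 < card (orbit (face_step \<sigma>) h)"
      using that n by simp_all
    then obtain j where "j < card (orbit (face_step \<sigma>) h)" "vcol \<kappa> (fst (belt \<sigma> h ! j)) = 0"
      "j = (0 + 2) mod card (orbit (face_step \<sigma>) h)"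
      using spec[OF bspec[OF rev h, unfolded reversed_belt_def length_belt], of 0] by blast
    then show ?thesis
      using n by (simp add: numeral_2_eq_2)
  qed
  ultimately have "ecol \<kappa> h \<noteq> 0"
    by metis
  moreover have "vcol \<kappa> (fst ((face_step \<sigma> ^^ 3) h)) = 0"
    unfolding steps using rainbow_belts_period4[OF rb g(1), of 0] g(2) by simp
  ultimately have "leftward \<kappa> h"
    using leftward_ecol(2)[OF etc rb h] by auto
  then show ?thesis
    using leftward_constant[OF etc rb e h] by simp
qed

lemma DETGCs_eq:
  "DETGCs G \<sigma> = {\<kappa>. ETGC G \<kappa> \<and> rainbow_belts (vcol \<kappa>) \<and> (\<forall>e \<in> parcs G. \<not> leftward \<kappa> e)}"
  unfolding DETGCs_def map_ETGC_def four_periodic_iff_rainbow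
  using directed_belt_of_not_leftward not_leftward_of_directed_belts by (auto simp: ETGC_def)

lemma RETGCs_eq:
  "RETGCs G \<sigma> = {\<kappa>. ETGC G \<kappa> \<and> rainbow_belts (vcol \<kappa>) \<and> (\<forall>e \<in> parcs G. leftward \<kappa> e)}"
  unfolding RETGCs_def map_ETGC_def four_periodic_iff_rainbow
  using reversed_belt_of_leftward leftward_of_reversed_belts by (auto simp: ETGC_def)

lemma periodic_ETGCs_eq: "{\<kappa>. periodic_ETGC G \<sigma> \<kappa>} = DETGCs G \<sigma> \<union> RETGCs G \<sigma>"
proof (intro equalityI subsetI)
  fix \<kappa>
  assume "\<kappa> \<in> {\<kappa>. periodic_ETGC G \<sigma> \<kappa>}"
  then have etgc: "ETGC G \<kappa>" and rb: "rainbow_belts (vcol \<kappa>)"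
    using periodic_ETGC_rainbow by (auto simp: periodic_ETGC_def)
  then have "ETC G \<kappa>"
    by (simp add: ETGC_def)
  then have "(\<forall>e \<in> parcs G. \<not> leftward \<kappa> e) \<or> (\<forall>e \<in> parcs G. leftward \<kappa> e)"
    using leftward_constant[OF _ rb] by blast
  then show "\<kappa> \<in> DETGCs G \<sigma> \<union> RETGCs G \<sigma>"
    using etgc rb by (auto simp: DETGCs_eq RETGCs_eq)
next
  fix \<kappa>
  assume "\<kappa> \<in> DETGCs G \<sigma> \<union> RETGCs G \<sigma>"
  then show "\<kappa> \<in> {\<kappa>. periodic_ETGC G \<sigma> \<kappa>}"
    using periodic_belt_of_constant[of \<kappa>]
    by (auto simp: DETGCs_eq RETGCs_eq periodic_ETGC_def ETGC_def)
qed

lemma flip_edges_exchanges: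
  "\<kappa> \<in> DETGCs G \<sigma> \<Longrightarrow> flip_edges G \<kappa> \<in> RETGCs G \<sigma>"
  "\<kappa> \<in> RETGCs G \<sigma> \<Longrightarrow> flip_edges G \<kappa> \<in> DETGCs G \<sigma>"
  using ETGC_flip_edges[of \<kappa>] leftward_flip_edges[of \<kappa>]
  by (simp_all add: DETGCs_eq RETGCs_eq ETGC_def)

text \<open>Hence either half of the periodic colourings induces all the face colourings.\<close>

lemma PFCs_eq:
  "PFCs G \<sigma> = face_coloring G \<sigma> ` DETGCs G \<sigma>"
  "PFCs G \<sigma> = face_coloring G \<sigma> ` RETGCs G \<sigma>"
proof -
  have "face_coloring G \<sigma> ` DETGCs G \<sigma> = face_coloring G \<sigma> ` RETGCs G \<sigma>"
    using flip_edges_exchanges face_coloring_flip_edges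
    by (metis (no_types, lifting) image_eqI image_subsetI subset_antisym)
  then show "PFCs G \<sigma> = face_coloring G \<sigma> ` DETGCs G \<sigma>"
    "PFCs G \<sigma> = face_coloring G \<sigma> ` RETGCs G \<sigma>"
    unfolding PFCs_def periodic_ETGCs_eq image_Un by simp_all
qed

end


section \<open>Recovering the vertex colours from the face colours\<close>

context cubic_rotation
begin

lemma no_common_rotation:
  assumes "distinct [a, b, c, d]"
    and "(a', b', c', d') \<in> {(a, b, c, d), (b, c, d, a), (c, d, a, b), (d, a, b, c)}"
    and "(a', c', d', b') \<in> {(a, c, d, b), (c, d, b, a), (d, b, a, c), (b, a, c, d)}"
  shows "a' = a"
  using assms(2)
proof (elim insertE emptyE)
qed (use assms(1,3) in auto)

lemma rotation_of_period4:
  assumes "\<And>i. y i = x ((i + s mod 4) mod 4 :: nat)"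
  shows "(y 0, y 1, y 2, y 3) \<in> {(x 0, x 1, x 2, x 3), (x 1, x 2, x 3, x 0),
    (x 2, x 3, x 0, x 1), (x 3, x 0, x 1, x 2)}"
proof -
  have "s mod 4 < 4"
    by simp
  then consider "s mod 4 = 0" | "s mod 4 = 1" | "s mod 4 = 2" | "s mod 4 = 3"
    by linarith
  then show ?thesis
    unfolding assms by cases (simp_all flip: numeral_2_eq_2)
qed

lemma face_coloring_orbit:
  assumes rb: "rainbow_belts (vcol \<kappa>)" and e: "e \<in> parcs G" and zero: "vcol \<kappa> (fst e) = 0"
  shows "face_coloring G \<sigma> \<kappa> (orbit (face_step \<sigma>) e) =
    map (\<lambda>i. vcol \<kappa> (fst ((face_step \<sigma> ^^ i) e))) [1, 2, 3]"
proof -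
  let ?F = "orbit (face_step \<sigma>) e"
  let ?w = "\<lambda>e. map (\<lambda>i. vcol \<kappa> (fst ((face_step \<sigma> ^^ i) e))) [1, 2, 3]"
  let ?x = "\<lambda>i. vcol \<kappa> (fst ((face_step \<sigma> ^^ i) e))"
  have "?w e' = ?w e" if e': "e' \<in> ?F" "vcol \<kappa> (fst e') = 0" for e'
  proof -
    obtain m where m: "e' = (face_step \<sigma> ^^ m) e"
      using e'(1) unfolding orbit_altdef by blast
    then have "?x m = ?x 0"
      using e'(2) zero by simp
    then have "m mod 4 = 0 mod 4"
      by (rule iffD1[OF rainbow_belts_eq_iff[OF rb e]])
    then have "(i + m) mod 4 = i mod 4" for i
      by presburger
    then have "?x (i + m) = ?x i" for i
      using rainbow_belts_eq_iff[OF rb e, of "i + m" i] by blast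
    moreover have "(face_step \<sigma> ^^ i) e' = (face_step \<sigma> ^^ (i + m)) e" for i
      by (simp only: m funpow_add comp_apply)
    ultimately show ?thesis
      by (simp only:)
  qed
  then have "(THE w. \<exists>e' \<in> ?F. vcol \<kappa> (fst e') = 0 \<and> w = ?w e') = ?w e"
    using face_step_orbit[OF e] zero by (intro the_equality) blast+
  then show ?thesis
    using e by (simp add: face_coloring_def faces_def)
qed

lemma face_colorings_shift:
  assumes rb: "rainbow_belts (vcol \<kappa>)" "rainbow_belts (vcol \<kappa>')" and e: "e \<in> parcs G"
    and eq: "face_coloring G \<sigma> \<kappa> = face_coloring G \<sigma> \<kappa>'"
  obtains s where "\<And>i. vcol \<kappa>' (fst ((face_step \<sigma> ^^ i) e)) = vcol \<kappa> (fst ((face_step \<sigma> ^^ (i + s)) e))"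
proof -
  let ?x = "\<lambda>i. vcol \<kappa> (fst ((face_step \<sigma> ^^ i) e))"
  let ?y = "\<lambda>i. vcol \<kappa>' (fst ((face_step \<sigma> ^^ i) e))"
  obtain p q where p: "?x p = 0" and q: "?y q = 0"
    using belt_zero[OF rb(1) e] belt_zero[OF rb(2) e] by metis
  have "cyclic_on (face_step \<sigma>) (orbit (face_step \<sigma>) e)"
    using face_step_orbit[OF e] by (intro cyclic_on_singleI) auto
  then have orbit: "orbit (face_step \<sigma>) ((face_step \<sigma> ^^ i) e) = orbit (face_step \<sigma>) e" for i
    using funpow_in_orbit[OF face_step_orbit[OF e]] by (rule orbit_cyclic_eq3)
  have shift: "(face_step \<sigma> ^^ i) ((face_step \<sigma> ^^ j) e) = (face_step \<sigma> ^^ (i + j)) e" for i j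
    by (simp only: funpow_add comp_apply)
  have "map (\<lambda>i. ?x (i + p)) [1, 2, 3] = map (\<lambda>i. ?y (i + q)) [1, 2, 3]"
    using face_coloring_orbit[OF rb(1) funpow_face_step_arc[OF e] p]
      face_coloring_orbit[OF rb(2) funpow_face_step_arc[OF e] q]
    unfolding shift orbit eq by simp
  then have small: "?x (i + p) = ?y (i + q)" if "i \<in> {0, 1, 2, 3}" for i
    using that p q by auto
  have all: "?x (i + p) = ?y (i + q)" for i
  proof -
    have "?x (i + p) = ?x (i mod 4 + p)"
      unfolding rainbow_belts_eq_iff[OF rb(1) e] by presburger
    also have "i mod 4 < 4"
      by simp
    then have "i mod 4 \<in> {0, 1, 2, 3}"
      by auto
    then have "?x (i mod 4 + p) = ?y (i mod 4 + q)"
      by (rule small)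
    also have "\<dots> = ?y (i + q)"
      unfolding rainbow_belts_eq_iff[OF rb(2) e] by presburger
    finally show ?thesis .
  qed
  have "?y i = ?x (i + (3 * q + p))" for i
  proof -
    have "?y i = ?y ((i + 3 * q) + q)"
      unfolding rainbow_belts_eq_iff[OF rb(2) e] by presburger
    also have "\<dots> = ?x (i + 3 * q + p)"
      by (rule all[symmetric])
    finally show ?thesis
      by (simp only: ac_simps)
  qed
  then show thesis
    by (rule that)
qed

text \<open>
  The face colouring determines the vertex colouring along each face up to a rotation of the
  face. Two faces that share an edge carry different cyclic orders of the four colours, neither
  the reverse of the other, and only the identity is a rotation of both of them.
\<close>

lemma vcol_determined:
  assumes etc: "ETC G \<kappa>" "ETC G \<kappa>'"
    and rb: "rainbow_belts (vcol \<kappa>)" "rainbow_belts (vcol \<kappa>')" and e: "e \<in> parcs G"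
    and eq: "face_coloring G \<sigma> \<kappa> = face_coloring G \<sigma> \<kappa>'"
  shows "vcol \<kappa> (fst e) = vcol \<kappa>' (fst e)"
proof -
  have rotation: "(a', b', c', d') \<in> {(a, b, c, d), (b, c, d, a), (c, d, a, b), (d, a, b, c)}"
    if g: "g \<in> parcs G"
      and "a = vcol \<kappa> (fst g)" "b = vcol \<kappa> (snd g)" "c = vcol \<kappa> (snd (\<sigma> g))"
      "d = vcol \<kappa> (snd (\<sigma> (\<sigma> g)))"
      and "a' = vcol \<kappa>' (fst g)" "b' = vcol \<kappa>' (snd g)" "c' = vcol \<kappa>' (snd (\<sigma> g))"
      "d' = vcol \<kappa>' (snd (\<sigma> (\<sigma> g)))"
    for g a b c d a' b' c' d'
  proof -
    let ?x = "\<lambda>i. vcol \<kappa> (fst ((face_step \<sigma> ^^ i) g))"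
    let ?y = "\<lambda>i. vcol \<kappa>' (fst ((face_step \<sigma> ^^ i) g))"
    obtain s where s: "\<And>i. ?y i = ?x (i + s)"
      using face_colorings_shift[OF rb g eq] by blast
    have x: "?x 0 = a" "?x 1 = b" "?x 2 = c" "?x 3 = d"
      using that(1-5) belt_colors_at_vertex[OF etc(1) rb(1) g] by simp_all
    have y: "?y 0 = a'" "?y 1 = b'" "?y 2 = c'" "?y 3 = d'"
      using that(1,6-9) belt_colors_at_vertex[OF etc(2) rb(2) g] by simp_all
    have red: "?y i = ?x ((i + s mod 4) mod 4)" for i
      unfolding s rainbow_belts_eq_iff[OF rb(1) g] by (simp only: mod_add_right_eq mod_mod_trivial)
    show ?thesis
      using rotation_of_period4[of ?y ?x s, OF red] unfolding x y by simp
  qed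
  note rotations = rotation[OF e refl refl refl refl refl refl refl refl]
    rotation[OF sigma_arc[OF e] refl refl refl refl refl refl refl refl,
      unfolded fst_sigma[OF e] sigma_star(1)[OF e]]
  show ?thesis
    using no_common_rotation[OF quad_distinct[OF ETC_vertex_star[OF etc(1) e]] rotations] by simp
qed

lemma total_col_eqI:
  assumes "ETC G \<kappa>" "ETC G \<kappa>'"
    and "\<And>e. e \<in> parcs G \<Longrightarrow> vcol \<kappa> (fst e) = vcol \<kappa>' (fst e)"
    and "\<And>e. e \<in> parcs G \<Longrightarrow> ecol \<kappa> e = ecol \<kappa>' e"
  shows "\<kappa> = \<kappa>'"
proof (rule PiE_ext)
  show "\<kappa> \<in> (pverts G <+> uedges G) \<rightarrow>\<^sub>E {0..3}" "\<kappa>' \<in> (pverts G <+> uedges G) \<rightarrow>\<^sub>E {0..3}"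
    using assms(1,2) by (simp_all add: ETC_def total_coloring_def)
  fix x
  assume "x \<in> pverts G <+> uedges G"
  then show "\<kappa> x = \<kappa>' x"
  proof (rule PlusE)
    fix v
    assume v: "v \<in> pverts G" "x = Inl v"
    have "{e \<in> parcs G. fst e = v} \<noteq> {}"
      using out_arcs_card[OF v(1)] by (metis card.empty zero_neq_numeral)
    then show "\<kappa> x = \<kappa>' x"
      using assms(3) v(2) by (auto simp: vcol_def)
  next
    fix d
    assume "d \<in> uedges G" "x = Inr d"
    then show "\<kappa> x = \<kappa>' x"
      using assms(4) by (auto simp: uedges_def ecol_def)
  qed
qed

lemma face_coloring_inj:
  assumes etc: "ETC G \<kappa>" "ETC G \<kappa>'"
    and rb: "rainbow_belts (vcol \<kappa>)" "rainbow_belts (vcol \<kappa>')"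
    and left: "\<And>e. e \<in> parcs G \<Longrightarrow> leftward \<kappa> e \<longleftrightarrow> leftward \<kappa>' e"
    and eq: "face_coloring G \<sigma> \<kappa> = face_coloring G \<sigma> \<kappa>'"
  shows "\<kappa> = \<kappa>'"
proof (rule total_col_eqI[OF etc])
  fix e
  assume e: "e \<in> parcs G"
  note vcol = vcol_determined[OF etc rb _ eq]
  show "vcol \<kappa> (fst e) = vcol \<kappa>' (fst e)"
    by (rule vcol[OF e])
  show "ecol \<kappa> e = ecol \<kappa>' e"
    using leftward_ecol[OF etc(1) rb(1) e] leftward_ecol[OF etc(2) rb(2) e] left[OF e]
      vcol[OF funpow_face_step_arc[OF e]] by metis
qed

end

theorem theorem33:
  fixes G :: "'a pair_pre_digraph" and \<sigma> :: "'a \<times> 'a \<Rightarrow> 'a \<times> 'a"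
  assumes "pair_graph G"
    and "connected (with_proj G)"
    and "cubic G"
    and "girth G = 4"
    and "Pi_map G \<sigma>"
  shows "bij_betw (face_coloring G \<sigma>) (DETGCs G \<sigma>) (PFCs G \<sigma>) \<and>
         bij_betw (face_coloring G \<sigma>) (RETGCs G \<sigma>) (PFCs G \<sigma>)"
proof -
  have "rotation_system G \<sigma>"
    using assms(5) by (simp add: Pi_map_def Y_map_def is_map_def)
  then interpret connected_cubic_rotation G \<sigma>
    using assms(1-3)
    by (simp add: connected_cubic_rotation_def connected_cubic_rotation_axioms_def
        cubic_rotation_def cubic_rotation_axioms_def)
  have "inj_on (face_coloring G \<sigma>) (DETGCs G \<sigma>)" "inj_on (face_coloring G \<sigma>) (RETGCs G \<sigma>)"
    by (rule inj_onI; rule face_coloring_inj;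
        simp add: DETGCs_eq RETGCs_eq ETGC_def)+
  then show ?thesis
    using PFCs_eq by (simp add: bij_betw_def)
qed

end
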